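(* Let $L$ be a solvable Leibniz algebra over a field $F$. If $\operatorname{char}F=p>0$, suppose also that $L^2$ has nilpotency class less than $p$. Let $M,K$ be maximal subalgebras of $L$. Then $M$ and $K$ are conjugate under $I(L,L^2)$ if and only if $M_L=K_L$.
   Context: Leibniz algebras are finite-dimensional left Leibniz algebras over a field: the product satisfies $x(yz)=(xy)z+y(xz)$, i.e. every left multiplication $L_x: y\mapsto xy$ is a derivation. Ideals are two-sided. $L^2$ is the span of all products $xy$ with $x,y\in L$. For $x\in L^2$, $\exp(L_x)=\sum_{r\ge 0}\frac{1}{r!}L_x^r$, which under the stated hypotheses is a finite sum ($L_x$ is nilpotent, with $L_x^p=0$ in characteristic $p$) and an automorphism of $L$. $I(L,L^2)$ is the subgroup of the automorphism group of $L$ generated by all $\exp(L_x)$, $x\in L^2$. Two subalgebras $U,V$ are conjugate under $I(L,L^2)$ if $\beta(U)=V$ for some $\beta\in I(L,L^2)$. For a subalgebra $U$ of $L$, its core $U_L$ is the largest ideal of $L$ contained in $U$. *)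

theory Defs
  imports Complex_Main "HOL-Algebra.Generated_Groups"
begin

locale leibniz_algebra = vector_space scale
  for scale :: "'f::field \<Rightarrow> 'a::ab_group_add \<Rightarrow> 'a" (infixr \<open>*s\<close> 75) +
  fixes prd :: "'a \<Rightarrow> 'a \<Rightarrow> 'a" (infixl \<open>\<bullet>\<close> 76)
  assumes finite_dim: "\<exists>B. finite B \<and> span B = UNIV"
    and linear_right: "Vector_Spaces.linear scale scale (\<lambda>y. x \<bullet> y)"
    and linear_left: "Vector_Spaces.linear scale scale (\<lambda>x. x \<bullet> y)"
    and left_leibniz: "x \<bullet> (y \<bullet> z) = (x \<bullet> y) \<bullet> z + y \<bullet> (x \<bullet> z)"
begin

definition subalgebra :: "'a set \<Rightarrow> bool" where
  "subalgebra U \<longleftrightarrow> subspace U \<and> (\<forall>x\<in>U. \<forall>y\<in>U. x \<bullet> y \<in> U)"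

definition ideal :: "'a set \<Rightarrow> bool" where
  "ideal I \<longleftrightarrow> subspace I \<and> (\<forall>x. \<forall>a\<in>I. x \<bullet> a \<in> I \<and> a \<bullet> x \<in> I)"

definition maximal_subalgebra :: "'a set \<Rightarrow> bool" where
  "maximal_subalgebra M \<longleftrightarrow> subalgebra M \<and> M \<noteq> UNIV \<and>
     (\<forall>U. subalgebra U \<longrightarrow> M \<subseteq> U \<longrightarrow> U = M \<or> U = UNIV)"

definition core :: "'a set \<Rightarrow> 'a set" where
  "core U = (GREATEST I. ideal I \<and> I \<subseteq> U)"

definition product_space :: "'a set \<Rightarrow> 'a set \<Rightarrow> 'a set" where
  "product_space U V = span {x \<bullet> y | x y. x \<in> U \<and> y \<in> V}"

abbreviation L2 :: "'a set" where
  "L2 \<equiv> product_space UNIV UNIV"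

primrec derived_series :: "'a set \<Rightarrow> nat \<Rightarrow> 'a set" where
  "derived_series U 0 = U"
| "derived_series U (Suc k) = product_space (derived_series U k) (derived_series U k)"

definition solvable :: "'a set \<Rightarrow> bool" where
  "solvable U \<longleftrightarrow> (\<exists>k. derived_series U k = {0})"

text \<open>The index is shifted by one: \<open>lower_central_series U k\<close> is the power \<open>U\<^sup>k\<^sup>+\<^sup>1\<close>,
  where \<open>U\<^sup>1 = U\<close> and \<open>U\<^sup>n\<^sup>+\<^sup>1 = U U\<^sup>n\<close>, so that the nilpotency class is the
  least \<open>k\<close> at which the sequence vanishes.\<close>

primrec lower_central_series :: "'a set \<Rightarrow> nat \<Rightarrow> 'a set" where
  "lower_central_series U 0 = U"
| "lower_central_series U (Suc k) = product_space U (lower_central_series U k)"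

definition nilpotent :: "'a set \<Rightarrow> bool" where
  "nilpotent U \<longleftrightarrow> (\<exists>k. lower_central_series U k = {0})"

definition nilpotency_class :: "'a set \<Rightarrow> nat" where
  "nilpotency_class U = (LEAST k. lower_central_series U k = {0})"

text \<open>The exponential series is summed over its nonzero powers of \<open>L\<^sub>x\<close>.  This set is finite
  exactly when \<open>L\<^sub>x\<close> is nilpotent; in characteristic \<open>p\<close> with \<open>L\<^sub>x\<^sup>p = 0\<close> only
  exponents below \<open>p\<close> occur, so that the factorials are invertible.\<close>

definition exp_L :: "'a \<Rightarrow> 'a \<Rightarrow> 'a" where
  "exp_L x y = (\<Sum>r | ((\<bullet>) x ^^ r) \<noteq> (\<lambda>_. 0). (1 / of_nat (fact r)) *s ((\<bullet>) x ^^ r) y)"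

definition automorphism :: "('a \<Rightarrow> 'a) \<Rightarrow> bool" where
  "automorphism f \<longleftrightarrow> Vector_Spaces.linear scale scale f \<and> bij f \<and> (\<forall>x y. f (x \<bullet> y) = f x \<bullet> f y)"

definition Aut :: "('a \<Rightarrow> 'a) monoid" where
  "Aut = \<lparr>carrier = {f. automorphism f}, mult = (\<circ>), one = id\<rparr>"

definition inner_Aut :: "('a \<Rightarrow> 'a) set" where
  "inner_Aut = generate Aut (exp_L ` L2)"

definition conjugate :: "('a \<Rightarrow> 'a) set \<Rightarrow> 'a set \<Rightarrow> 'a set \<Rightarrow> bool" where
  "conjugate G U V \<longleftrightarrow> (\<exists>\<beta>\<in>G. \<beta> ` U = V)"

text \<open>The largest ideal inside a subspace exists, so \<open>core\<close> is well defined.\<close>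

lemma ideal_span_Union:
  assumes "\<And>I. I \<in> \<C> \<Longrightarrow> ideal I"
  shows "ideal (span (\<Union>\<C>))"
proof -
  have "x \<bullet> a \<in> span (\<Union>\<C>) \<and> a \<bullet> x \<in> span (\<Union>\<C>)" if "a \<in> span (\<Union>\<C>)" for x a
    using that
  proof (induction rule: span_induct)
    case base
    interpret r: Vector_Spaces.linear scale scale "\<lambda>y. x \<bullet> y" by (rule linear_right)
    interpret l: Vector_Spaces.linear scale scale "\<lambda>y. y \<bullet> x" by (rule linear_left)
    show ?case
      by (auto simp: subspace_def r.zero l.zero r.add l.add r.scale l.scale
          intro: span_zero span_add span_scale)
  next
    case (step a)
    then show ?case
      using assms by (auto simp: ideal_def intro!: span_base)
  qed
  then show ?thesis
    by (auto simp: ideal_def subspace_span)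
qed

lemma core_greatest:
  assumes "subspace U"
  shows "ideal (core U)" and "core U \<subseteq> U"
    and "\<And>J. ideal J \<Longrightarrow> J \<subseteq> U \<Longrightarrow> J \<subseteq> core U"
proof -
  define S where "S = span (\<Union>{I. ideal I \<and> I \<subseteq> U})"
  have "ideal S"
    unfolding S_def by (rule ideal_span_Union) simp
  moreover have "S \<subseteq> U"
    unfolding S_def using assms by (intro span_minimal) auto
  moreover have "J \<subseteq> S" if "ideal J" "J \<subseteq> U" for J
    using that unfolding S_def by (auto intro: span_base)
  moreover from calculation have "core U = S"
    unfolding core_def by (intro Greatest_equality) auto
  ultimately show "ideal (core U)" "core U \<subseteq> U" "\<And>J. ideal J \<Longrightarrow> J \<subseteq> U \<Longrightarrow> J \<subseteq> core U"
    by auto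
qed

end

end

theory Submission
  imports Defs "HOL-Computational_Algebra.Polynomial" "HOL-Computational_Algebra.Primes"
begin

text \<open>Inner automorphisms fix every ideal, which gives the forward direction.  For the converse let
  \<open>I = M\<^sub>L = K\<^sub>L\<close> and let \<open>A/I\<close> be a chief factor.  Modulo \<open>I\<close> both \<open>M\<close> and \<open>K\<close> complement the abelian
  ideal \<open>A\<close>, on which \<open>M\<close> acts faithfully and irreducibly.  Some element of an abelian ideal of \<open>M/I\<close> is
  therefore invertible on \<open>A/I\<close>; this makes the cocycle relating \<open>M\<close> and \<open>K\<close> a coboundary, so that
  \<open>K = exp(L\<^sub>x)(M)\<close> for some \<open>x \<in> A \<inter> L\<^sup>2\<close>.  The characteristic enters only through the exponentials: in
  characteristic \<open>0\<close>, \<open>L\<^sub>x\<close> is nilpotent for \<open>x \<in> L\<^sup>2\<close> by a form of Lie's theorem, proved here over an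
  arbitrary field of characteristic \<open>0\<close> via derivatives of annihilating polynomials.  Quotients are
  avoided throughout by working modulo a subspace.\<close>

text \<open>The obstacle peculiar to Leibniz algebras is that left and right multiplications are a
  priori unrelated. On a chief factor it disappears: comparison with the Leibniz kernel shows that
  modulo \<open>I\<close> the products \<open>a \<bullet> x\<close> with \<open>a\<close> in
  \<open>A\<close> either all vanish or equal \<open>- (x \<bullet> a)\<close>, so left submodules
  suffice. Over an arbitrary field no eigenvectors are available; instead, an element of an abelian
  ideal acts on an irreducible factor either nilpotently or injectively, and if all act nilpotently
  they act as zero. Faithfulness then supplies the invertible element. The conjugating
  \<open>x\<close> must also lie in \<open>L2\<close>: unless \<open>x = 0\<close> works, that
  element is inverted twice, which makes \<open>x\<close> a product up to sign. As \<open>x\<close>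
  multiplies \<open>A\<close> into \<open>I\<close>, \<open>exp(L_x)\<close> is
  \<open>1 + L_x\<close> modulo \<open>I\<close>, so it realises exactly a coboundary.\<close>

context leibniz_algebra
begin

section \<open>Bilinear calculus and finite dimension\<close>

lemma prd_add_right: "x \<bullet> (y + z) = x \<bullet> y + x \<bullet> z"
  and prd_scale_right: "x \<bullet> (c *s y) = c *s (x \<bullet> y)"
proof -
  interpret r: Vector_Spaces.linear scale scale "\<lambda>y. x \<bullet> y" by (rule linear_right)
  show "x \<bullet> (y + z) = x \<bullet> y + x \<bullet> z" "x \<bullet> (c *s y) = c *s (x \<bullet> y)"
    by (rule r.add r.scale)+
qed

lemma prd_add_left: "(x + y) \<bullet> z = x \<bullet> z + y \<bullet> z"
  and prd_scale_left: "(c *s x) \<bullet> z = c *s (x \<bullet> z)"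
proof -
  interpret l: Vector_Spaces.linear scale scale "\<lambda>x. x \<bullet> z" by (rule linear_left)
  show "(x + y) \<bullet> z = x \<bullet> z + y \<bullet> z" "(c *s x) \<bullet> z = c *s (x \<bullet> z)"
    by (rule l.add l.scale)+
qed

lemma prd_zero_right [simp]: "x \<bullet> 0 = 0"
  using prd_scale_right[of x 0 0] by simp

lemma prd_zero_left [simp]: "0 \<bullet> x = 0"
  using prd_scale_left[of 0 0 x] by simp

lemma prd_minus_right: "x \<bullet> (- y) = - (x \<bullet> y)"
  using prd_scale_right[of x "-1" y] by simp

lemma prd_minus_left: "(- x) \<bullet> y = - (x \<bullet> y)"
  using prd_scale_left[of "-1" x y] by simp

lemma prd_diff_right: "x \<bullet> (y - z) = x \<bullet> y - x \<bullet> z"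
  using prd_add_right[of x y "-z"] by (simp add: prd_minus_right)

lemma prd_diff_left: "(x - y) \<bullet> z = x \<bullet> z - y \<bullet> z"
  using prd_add_left[of x "-y" z] by (simp add: prd_minus_left)

lemmas prd_distribs = prd_add_right prd_add_left prd_diff_right prd_diff_left
  prd_minus_right prd_minus_left prd_scale_right prd_scale_left

lemma prd_prd_left: "(x \<bullet> y) \<bullet> z = x \<bullet> (y \<bullet> z) - y \<bullet> (x \<bullet> z)"
  using left_leibniz[of x y z] by simp

lemma square_prd: "(x \<bullet> x) \<bullet> z = 0"
  by (simp add: prd_prd_left)

lemma subspace_prd_left_preimage: "subspace W \<Longrightarrow> subspace {x. x \<bullet> v \<in> W}"
  and subspace_prd_right_preimage: "subspace W \<Longrightarrow> subspace {v. x \<bullet> v \<in> W}"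
  by (auto simp: subspace_def prd_distribs)

text \<open>\<open>finite_dimensional_vector_space\<close> takes a fixed basis as parameter, while
  the algebra only comes with some finite spanning set, so a basis is chosen once.\<close>

definition fin_basis :: "'a set" where
  "fin_basis = (SOME B. finite B \<and> independent B \<and> span B = UNIV)"

lemma fin_basis: "finite fin_basis" "independent fin_basis" "span fin_basis = UNIV"
proof -
  obtain B0 where B0: "finite B0" "span B0 = UNIV"
    using finite_dim by blast
  obtain B where B: "B \<subseteq> B0" "independent B" "B0 \<subseteq> span B"
    using maximal_independent_subset[of B0] by blast
  have "span B = span B0"
    using B(1,3) by (intro subset_antisym span_mono span_minimal subspace_span)
  then have "\<exists>B. finite B \<and> independent B \<and> span B = UNIV"
    using B(2) B0(2) finite_subset[OF B(1) B0(1)] by metis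
  then have "finite fin_basis \<and> independent fin_basis \<and> span fin_basis = UNIV"
    unfolding fin_basis_def by (rule someI_ex)
  then show "finite fin_basis" "independent fin_basis" "span fin_basis = UNIV"
    by blast+
qed

sublocale fd: finite_dimensional_vector_space scale fin_basis
  by unfold_locales (use fin_basis in auto)

lemma finite_spanning_subset:
  obtains B where "finite B" "B \<subseteq> G" "G \<subseteq> span B"
  using maximal_independent_subset[of G] fd.finiteI_independent by metis

lemma dim_stationary:
  fixes V :: "nat \<Rightarrow> 'a set"
  assumes "\<And>k. subspace (V k)" "\<And>k. V (Suc k) \<subseteq> V k"
  obtains k where "V (Suc k) = V k"
proof -
  obtain k where k: "\<And>j. dim (V k) \<le> dim (V j)"
    using ex_has_least_nat[of "\<lambda>_. True" 0 "\<lambda>k. dim (V k)"] by auto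
  show ?thesis
    by (rule that[of k]) (rule fd.subspace_dim_equal; use assms k in auto)
qed

lemma finite_dim_maximal:
  assumes "P W0" "\<And>W. P W \<Longrightarrow> subspace W"
  obtains W where "P W" "\<And>J. P J \<Longrightarrow> W \<subseteq> J \<Longrightarrow> J = W"
proof -
  obtain W where W: "P W" "\<And>J. P J \<Longrightarrow> dim J \<le> dim W"
    using ex_has_greatest_nat[of P W0 dim "Suc fd.dimension"] assms(1)
      fd.dim_subset_UNIV le_imp_less_Suc by blast
  show ?thesis
    by (rule that[OF W(1)]) (metis W assms(2) fd.subspace_dim_equal)
qed

lemma finite_dim_minimal:
  assumes "P W0" "\<And>W. P W \<Longrightarrow> subspace W"
  obtains W where "P W" "\<And>J. P J \<Longrightarrow> J \<subseteq> W \<Longrightarrow> J = W"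
proof -
  obtain W where W: "P W" "\<And>J. P J \<Longrightarrow> dim W \<le> dim J"
    using ex_has_least_nat[of P W0 dim] assms(1) by metis
  show ?thesis
    by (rule that[OF W(1)]) (metis W assms(2) fd.subspace_dim_equal)
qed

subsection \<open>Irreducible factors\<close>

text \<open>These are the submodules for the left action. \<open>M\<close> is an arbitrary set, so
  that a single operator is covered by \<open>M = {x}\<close>.\<close>

definition left_stable :: "'a set \<Rightarrow> 'a set \<Rightarrow> bool" where
  "left_stable M V \<longleftrightarrow> subspace V \<and> (\<forall>x\<in>M. \<forall>v\<in>V. x \<bullet> v \<in> V)"

lemma left_stable_subspace: "left_stable M V \<Longrightarrow> subspace V"
  by (simp add: left_stable_def)

lemma left_stableD: "left_stable M V \<Longrightarrow> x \<in> M \<Longrightarrow> v \<in> V \<Longrightarrow> x \<bullet> v \<in> V"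
  by (simp add: left_stable_def)

text \<open>\<open>L_(x \<bullet> y)\<close> is the commutator of \<open>L_x\<close> and
  \<open>L_y\<close>, so it preserves \<open>V\<close> even when \<open>x \<bullet> y\<close> lies
  outside \<open>M\<close>.\<close>

lemma left_stable_prdD:
  assumes "left_stable M V" "x \<in> M" "y \<in> M" "v \<in> V"
  shows "(x \<bullet> y) \<bullet> v \<in> V"
  using assms by (auto simp: prd_prd_left left_stable_def intro!: subspace_diff)

lemma pow_left_stable:
  assumes "left_stable M V" "x \<in> M" "v \<in> V"
  shows "((\<bullet>) x ^^ k) v \<in> V"
  using assms by (induction k) (auto simp: left_stableD)

lemma pow_left_stable_mono:
  assumes "left_stable M W" "x \<in> M" "((\<bullet>) x ^^ k) v \<in> W" "k \<le> l"
  shows "((\<bullet>) x ^^ l) v \<in> W"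
  using pow_left_stable[OF assms(1-3), of "l - k"] assms(4)
  by (metis comp_apply funpow_add le_add_diff_inverse2)

lemma pow_add: "((\<bullet>) x ^^ k) (v + w) = ((\<bullet>) x ^^ k) v + ((\<bullet>) x ^^ k) w"
  by (induction k) (auto simp: prd_add_right)

lemma pow_scale: "((\<bullet>) x ^^ k) (c *s v) = c *s ((\<bullet>) x ^^ k) v"
  by (induction k) (auto simp: prd_scale_right)

lemma pow_diff: "((\<bullet>) x ^^ k) (v - w) = ((\<bullet>) x ^^ k) v - ((\<bullet>) x ^^ k) w"
  by (induction k) (auto simp: prd_diff_right)

lemma pow_zero [simp]: "((\<bullet>) x ^^ k) 0 = 0"
  by (induction k) auto

definition irr_factor :: "'a set \<Rightarrow> 'a set \<Rightarrow> 'a set \<Rightarrow> bool" where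
  "irr_factor M V W \<longleftrightarrow> left_stable M V \<and> left_stable M W \<and> W \<subset> V \<and>
     (\<forall>J. left_stable M J \<longrightarrow> W \<subseteq> J \<longrightarrow> J \<subseteq> V \<longrightarrow> J = W \<or> J = V)"

text \<open>The Fitting null component of \<open>L\<^sub>x\<close> on \<open>V/W\<close> is stable under \<open>M\<close> because \<open>L\<^sub>x\<close> commutes
  with \<open>[L\<^sub>y, L\<^sub>x]\<close> for \<open>y \<in> M\<close>.\<close>

lemma fitting_alternative:
  assumes irr: "irr_factor M V W" and x: "x \<in> M"
    and comm: "\<And>y v. y \<in> M \<Longrightarrow> v \<in> V \<Longrightarrow> x \<bullet> ((y \<bullet> x) \<bullet> v) - (y \<bullet> x) \<bullet> (x \<bullet> v) \<in> W"
  shows "(\<forall>v\<in>V. \<exists>k. ((\<bullet>) x ^^ k) v \<in> W) \<or> (\<forall>v\<in>V. x \<bullet> v \<in> W \<longrightarrow> v \<in> W)"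
proof -
  have V: "left_stable M V" and W: "left_stable M W" and "W \<subseteq> V"
    using irr by (auto simp: irr_factor_def)
  note sV = left_stable_subspace[OF V] and sW = left_stable_subspace[OF W]
  define J where "J = {v \<in> V. \<exists>k. ((\<bullet>) x ^^ k) v \<in> W}"
  have sJ: "subspace J"
    unfolding J_def
  proof (rule subspaceI, goal_cases)
    case 1
    show ?case using sV sW by (auto simp: subspace_0 intro!: exI[of _ 0])
  next
    case (2 v w)
    then obtain k l where "((\<bullet>) x ^^ k) v \<in> W" "((\<bullet>) x ^^ l) w \<in> W" by auto
    then have "((\<bullet>) x ^^ max k l) v \<in> W" "((\<bullet>) x ^^ max k l) w \<in> W"
      using pow_left_stable_mono[OF W x] by auto
    then show ?case
      using 2 sV sW by (auto simp: pow_add subspace_add intro!: exI[of _ "max k l"])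
  next
    case (3 c v)
    then show ?case using sV sW by (auto simp: pow_scale intro: subspace_scale)
  qed
  have commJ: "(y \<bullet> x) \<bullet> v \<in> J" if y: "y \<in> M" and v: "v \<in> J" for y v
  proof -
    have diff: "((\<bullet>) x ^^ k) ((y \<bullet> x) \<bullet> u) - (y \<bullet> x) \<bullet> ((\<bullet>) x ^^ k) u \<in> W" if "u \<in> V" for u k
    proof (induction k)
      case 0
      show ?case using sW by (simp add: subspace_0)
    next
      case (Suc k)
      have "x \<bullet> (((\<bullet>) x ^^ k) ((y \<bullet> x) \<bullet> u) - (y \<bullet> x) \<bullet> ((\<bullet>) x ^^ k) u) +
        (x \<bullet> ((y \<bullet> x) \<bullet> ((\<bullet>) x ^^ k) u) - (y \<bullet> x) \<bullet> (x \<bullet> ((\<bullet>) x ^^ k) u)) \<in> W"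
        using Suc x y that V W
        by (intro subspace_add[OF sW] left_stableD[OF W] comm pow_left_stable[OF V]) auto
      then show ?case by (simp add: prd_diff_right)
    qed
    obtain k where k: "((\<bullet>) x ^^ k) v \<in> W" and vV: "v \<in> V" using v by (auto simp: J_def)
    have "((\<bullet>) x ^^ k) ((y \<bullet> x) \<bullet> v) \<in> W"
      using subspace_add[OF sW diff[OF vV, of k] left_stable_prdD[OF W y x k]] by simp
    then show ?thesis
      using left_stable_prdD[OF V y x vV] by (auto simp: J_def)
  qed
  \<comment> \<open>Induction on the exponent: \<open>x \<bullet> v\<close> needs one power less,
    and \<open>x \<bullet> (y \<bullet> v) = y \<bullet> (x \<bullet> v) - (y \<bullet> x) \<bullet>
    v\<close> then puts \<open>x \<bullet> (y \<bullet> v)\<close>, hence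
    \<open>y \<bullet> v\<close>, into \<open>J\<close>.\<close>
  have step: "y \<bullet> v \<in> J" if y: "y \<in> M" and "v \<in> V" "((\<bullet>) x ^^ k) v \<in> W" for y v k
    using that(2,3)
  proof (induction k arbitrary: v)
    case 0
    then show ?case
      using y W \<open>W \<subseteq> V\<close> by (auto simp: J_def left_stableD intro!: exI[of _ 0])
  next
    case (Suc k)
    have xv: "y \<bullet> (x \<bullet> v) \<in> J"
      using Suc.prems by (intro Suc.IH) (auto simp: funpow_swap1 left_stableD[OF V x])
    have "v \<in> J" using Suc.prems by (auto simp: J_def simp del: funpow.simps)
    then have "y \<bullet> (x \<bullet> v) - (y \<bullet> x) \<bullet> v \<in> J"
      using subspace_diff[OF sJ xv commJ[OF y]] by simp
    then have "x \<bullet> (y \<bullet> v) \<in> J"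
      by (simp add: prd_prd_left)
    then obtain l where "((\<bullet>) x ^^ l) (x \<bullet> (y \<bullet> v)) \<in> W" by (auto simp: J_def)
    then have "((\<bullet>) x ^^ Suc l) (y \<bullet> v) \<in> W" by (simp add: funpow_swap1)
    then show ?case
      using left_stableD[OF V y Suc.prems(1)] unfolding J_def by blast
  qed
  have "left_stable M J"
    unfolding left_stable_def using sJ step by (auto simp: J_def)
  moreover have "W \<subseteq> J" using \<open>W \<subseteq> V\<close> by (auto simp: J_def intro!: exI[of _ 0])
  moreover have "J \<subseteq> V" by (auto simp: J_def)
  ultimately consider "J = W" | "J = V" using irr by (auto simp: irr_factor_def)
  then show ?thesis
  proof cases
    case 1
    have "v \<in> W" if "v \<in> V" "x \<bullet> v \<in> W" for v
      using that 1 by (auto simp: J_def set_eq_iff dest!: spec[of _ v] intro: exI[of _ 1])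
    then show ?thesis by blast
  next
    case 2
    then show ?thesis by (auto simp: J_def)
  qed
qed

text \<open>The images of the powers of \<open>L_x\<close> on \<open>V/W\<close> stabilise by finite
  dimension, so \<open>L_x^k v\<close> agrees with some \<open>L_x^(k+1) u\<close> modulo
  \<open>W\<close>, and injectivity cancels \<open>L_x^k\<close>.\<close>

lemma surj_mod_of_inj_mod:
  assumes V: "left_stable {x} V" and W: "left_stable {x} W" and WV: "W \<subseteq> V"
    and inj: "\<And>v. v \<in> V \<Longrightarrow> x \<bullet> v \<in> W \<Longrightarrow> v \<in> W" and v: "v \<in> V"
  obtains u where "u \<in> V" "v - x \<bullet> u \<in> W"
proof -
  note sV = left_stable_subspace[OF V] and sW = left_stable_subspace[OF W]
  define U where "U k = {((\<bullet>) x ^^ k) u + w | u w. u \<in> V \<and> w \<in> W}" for k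
  have sU: "subspace (U k)" for k
  proof (rule subspaceI, goal_cases)
    case 1
    have "0 = ((\<bullet>) x ^^ k) 0 + 0" by simp
    then show ?case unfolding U_def using subspace_0[OF sV] subspace_0[OF sW] by blast
  next
    case (2 a b)
    then obtain u w u' w' where "a = ((\<bullet>) x ^^ k) u + w" "b = ((\<bullet>) x ^^ k) u' + w'"
      "u \<in> V" "w \<in> W" "u' \<in> V" "w' \<in> W" by (auto simp: U_def)
    then have "a + b = ((\<bullet>) x ^^ k) (u + u') + (w + w')" "u + u' \<in> V" "w + w' \<in> W"
      using sV sW by (auto simp: pow_add subspace_add)
    then show ?case unfolding U_def by blast
  next
    case (3 c a)
    then obtain u w where "a = ((\<bullet>) x ^^ k) u + w" "u \<in> V" "w \<in> W" by (auto simp: U_def)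
    then have "c *s a = ((\<bullet>) x ^^ k) (c *s u) + c *s w" "c *s u \<in> V" "c *s w \<in> W"
      using sV sW by (auto simp: pow_scale scale_right_distrib subspace_scale)
    then show ?case unfolding U_def by blast
  qed
  have "U (Suc k) \<subseteq> U k" for k
  proof
    fix a assume "a \<in> U (Suc k)"
    then obtain u w where "u \<in> V" "w \<in> W" "a = ((\<bullet>) x ^^ k) (x \<bullet> u) + w"
      by (auto simp: U_def funpow_swap1)
    then show "a \<in> U k" using left_stableD[OF V, of x u] unfolding U_def by blast
  qed
  then obtain k where k: "U (Suc k) = U k"
    using dim_stationary[of U] sU by metis
  have "((\<bullet>) x ^^ k) v \<in> U k"
    unfolding U_def using v subspace_0[OF sW] add.right_neutral[of "((\<bullet>) x ^^ k) v"]
    by (metis (mono_tags, lifting) mem_Collect_eq)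
  then have "((\<bullet>) x ^^ k) v \<in> U (Suc k)" using k by simp
  then obtain u w where u: "u \<in> V" "w \<in> W" "((\<bullet>) x ^^ k) v = ((\<bullet>) x ^^ Suc k) u + w"
    by (auto simp: U_def)
  have "((\<bullet>) x ^^ k) (v - x \<bullet> u) = w"
    using u(3) by (simp add: pow_diff funpow_swap1)
  then have mem: "((\<bullet>) x ^^ k) (v - x \<bullet> u) \<in> W" using u by simp
  have pull: "z \<in> W" if "z \<in> V" "((\<bullet>) x ^^ j) z \<in> W" for z j
    using that
  proof (induction j arbitrary: z)
    case (Suc j)
    then have "x \<bullet> z \<in> W" using left_stableD[OF V, of x] by (auto simp: funpow_swap1)
    then show ?case using inj Suc.prems by blast
  qed simp
  have "v - x \<bullet> u \<in> V" using v u left_stableD[OF V, of x] sV by (auto intro: subspace_diff)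
  then show ?thesis using that u pull mem by blast
qed

text \<open>The operators commute on \<open>V/W\<close>, so they can be treated one at a time: the
  last nonzero power \<open>L_x^j v\<close> is killed by \<open>x\<close> and, by commutation, still
  by all operators treated before.\<close>

lemma common_kernel:
  assumes "finite S" and V: "left_stable S V" and W: "left_stable S W" and "\<not> V \<subseteq> W"
    and comm: "\<And>x y v. x \<in> S \<Longrightarrow> y \<in> S \<Longrightarrow> v \<in> V \<Longrightarrow> x \<bullet> (y \<bullet> v) - y \<bullet> (x \<bullet> v) \<in> W"
    and nil: "\<And>x v. x \<in> S \<Longrightarrow> v \<in> V \<Longrightarrow> \<exists>k. ((\<bullet>) x ^^ k) v \<in> W"
  shows "\<exists>v\<in>V - W. \<forall>x\<in>S. x \<bullet> v \<in> W"
proof -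
  note sW = left_stable_subspace[OF W]
  have "\<exists>v\<in>V - W. \<forall>x\<in>T. x \<bullet> v \<in> W" if "finite T" "T \<subseteq> S" for T
    using that
  proof (induction T)
    case empty
    then show ?case using assms(4) by auto
  next
    case (insert x T)
    then obtain v where v: "v \<in> V" "v \<notin> W" "\<And>y. y \<in> T \<Longrightarrow> y \<bullet> v \<in> W" by auto
    have x: "x \<in> S" using insert by auto
    define k where "k = (LEAST k. ((\<bullet>) x ^^ k) v \<in> W)"
    have k: "((\<bullet>) x ^^ k) v \<in> W" unfolding k_def using nil[OF x v(1)] by (rule LeastI_ex)
    have "k \<noteq> 0" using k v by (cases k) auto
    then obtain j where j: "k = Suc j" by (cases k) auto
    have notW: "((\<bullet>) x ^^ j) v \<notin> W" using not_less_Least[of j "\<lambda>k. ((\<bullet>) x ^^ k) v \<in> W"] j by (auto simp: k_def)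
    have "y \<bullet> ((\<bullet>) x ^^ i) v \<in> W" if y: "y \<in> T" for y i
    proof (induction i)
      case 0
      then show ?case using v y by simp
    next
      case (Suc i)
      have "y \<bullet> (x \<bullet> ((\<bullet>) x ^^ i) v) - x \<bullet> (y \<bullet> ((\<bullet>) x ^^ i) v) \<in> W"
        using x y insert.prems v(1) by (intro comm pow_left_stable[OF V]) auto
      then show ?case using subspace_add[OF sW _ left_stableD[OF W x Suc]] by force
    qed
    then have "\<forall>y\<in>insert x T. y \<bullet> ((\<bullet>) x ^^ j) v \<in> W" using k j by auto
    then show ?case using notW pow_left_stable[OF V x v(1)] by blast
  qed
  then show ?thesis using assms(1) by auto
qed

lemma span_prd_left:
  assumes "x \<in> span G" "subspace W" "\<And>g. g \<in> G \<Longrightarrow> g \<bullet> v \<in> W"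
  shows "x \<bullet> v \<in> W"
  using assms(1)
proof (induction rule: span_induct)
  case base
  show ?case
    by (rule subspace_prd_left_preimage[OF assms(2)])
qed (use assms in auto)

text \<open>By the Fitting alternative, if no generator is injective on \<open>V/W\<close>, all are
  nilpotent there and have a common kernel; it is a submodule because \<open>span G\<close> is
  stable under \<open>M\<close>, so irreducibility makes it everything. The injective element is
  found in \<open>G\<close> itself, not just in the span, so that later it can be a single
  product.\<close>

lemma irr_factor_trivial_or_inj:
  assumes irr: "irr_factor M V W" and GM: "span G \<subseteq> M"
    and ideal: "\<And>x y. y \<in> M \<Longrightarrow> x \<in> span G \<Longrightarrow> y \<bullet> x \<in> span G"
    and comm: "\<And>x y v. x \<in> span G \<Longrightarrow> y \<in> span G \<Longrightarrow> v \<in> V \<Longrightarrow> (x \<bullet> y) \<bullet> v \<in> W"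
  shows "(\<forall>x\<in>span G. \<forall>v\<in>V. x \<bullet> v \<in> W) \<or> (\<exists>x\<in>G. \<forall>v\<in>V. x \<bullet> v \<in> W \<longrightarrow> v \<in> W)"
proof (rule disjCI)
  assume noinj: "\<not> (\<exists>x\<in>G. \<forall>v\<in>V. x \<bullet> v \<in> W \<longrightarrow> v \<in> W)"
  have V: "left_stable M V" and W: "left_stable M W" and "W \<subset> V"
    using irr by (auto simp: irr_factor_def)
  note sV = left_stable_subspace[OF V] and sW = left_stable_subspace[OF W]
  have nil: "\<exists>k. ((\<bullet>) x ^^ k) v \<in> W" if "x \<in> G" "v \<in> V" for x v
  proof -
    have xM: "x \<in> M" using GM that span_base by blast
    have "x \<bullet> ((y \<bullet> x) \<bullet> u) - (y \<bullet> x) \<bullet> (x \<bullet> u) \<in> W" if "y \<in> M" "u \<in> V" for y u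
      using comm[of x "y \<bullet> x" u] \<open>x \<in> G\<close> that ideal span_base by (simp add: prd_prd_left[of x])
    from fitting_alternative[OF irr xM this] show ?thesis
      using noinj that by blast
  qed
  obtain B where B: "finite B" "B \<subseteq> G" "G \<subseteq> span B"
    by (rule finite_spanning_subset)
  have BM: "B \<subseteq> M" using B GM span_superset by blast
  have "\<exists>v\<in>V - W. \<forall>x\<in>B. x \<bullet> v \<in> W"
  proof (rule common_kernel)
    show "left_stable B V" "left_stable B W" using V W BM by (auto simp: left_stable_def)
    show "x \<bullet> (y \<bullet> v) - y \<bullet> (x \<bullet> v) \<in> W" if "x \<in> B" "y \<in> B" "v \<in> V" for x y v
      using comm[of x y v] that B span_base by (auto simp: prd_prd_left)
  qed (use B \<open>W \<subset> V\<close> nil in auto)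
  then obtain v where v: "v \<in> V" "v \<notin> W" "\<And>x. x \<in> B \<Longrightarrow> x \<bullet> v \<in> W" by auto
  define J where "J = {v \<in> V. \<forall>x\<in>span G. x \<bullet> v \<in> W}"
  have "span G \<subseteq> span B" using B by (simp add: span_minimal)
  then have vJ: "v \<in> J" using v span_prd_left[OF _ sW, of _ B v] by (auto simp: J_def)
  have "left_stable M J"
    unfolding left_stable_def
  proof (intro conjI ballI)
    show "subspace J"
      using sV sW by (auto simp: J_def subspace_def prd_distribs)
    fix y u assume y: "y \<in> M" and u: "u \<in> J"
    have "x \<bullet> (y \<bullet> u) \<in> W" if x: "x \<in> span G" for x
    proof -
      have "y \<bullet> (x \<bullet> u) - (y \<bullet> x) \<bullet> u \<in> W"
        using u x y ideal left_stableD[OF W] by (intro subspace_diff[OF sW]) (auto simp: J_def)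
      then show ?thesis by (simp add: prd_prd_left)
    qed
    then show "y \<bullet> u \<in> J" using u y left_stableD[OF V] by (auto simp: J_def)
  qed
  moreover have "W \<subseteq> J"
    using \<open>W \<subset> V\<close> GM left_stableD[OF W] by (auto simp: J_def)
  moreover have "J \<subseteq> V" by (auto simp: J_def)
  ultimately have "J = V" using irr vJ v by (auto simp: irr_factor_def)
  then show "\<forall>x\<in>span G. \<forall>v\<in>V. x \<bullet> v \<in> W" by (auto simp: J_def)
qed

subsection \<open>Nilpotency of left multiplications in characteristic zero\<close>

text \<open>This is \<open>p(L_t) v\<close> in Horner form.\<close>

definition poly_act :: "'a \<Rightarrow> 'f poly \<Rightarrow> 'a \<Rightarrow> 'a" where
  "poly_act t p v = fold_coeffs (\<lambda>a u. a *s v + t \<bullet> u) p 0"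

lemma poly_act_0 [simp]: "poly_act t 0 v = 0"
  by (simp add: poly_act_def)

lemma poly_act_pCons [simp]: "poly_act t (pCons a p) v = a *s v + t \<bullet> poly_act t p v"
  by (cases "p = 0 \<and> a = 0") (auto simp: poly_act_def fold_coeffs_def cCons_def)

lemma poly_act_1 [simp]: "poly_act t 1 v = v"
  by (simp add: one_pCons)

lemma poly_act_add: "poly_act t (p + q) v = poly_act t p v + poly_act t q v"
  by (induction p q rule: poly_induct2) (auto simp: prd_distribs algebra_simps)

lemma poly_act_smult: "poly_act t (smult c p) v = c *s poly_act t p v"
  by (induction p) (auto simp: prd_distribs algebra_simps)

lemma poly_act_add_right: "poly_act t p (v + w) = poly_act t p v + poly_act t p w"
  by (induction p) (auto simp: prd_distribs algebra_simps)

lemma poly_act_scale_right: "poly_act t p (c *s v) = c *s poly_act t p v"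
  by (induction p) (auto simp: prd_distribs algebra_simps)

lemma poly_act_zero_right [simp]: "poly_act t p 0 = 0"
  by (induction p) auto

lemma poly_act_mult: "poly_act t (p * q) v = poly_act t p (poly_act t q v)"
  by (induction p) (auto simp: poly_act_add poly_act_smult)

lemma poly_act_monom: "poly_act t (monom 1 k) v = ((\<bullet>) t ^^ k) v"
  by (induction k) (auto simp: monom_0 monom_Suc)

lemma poly_act_left_stable:
  assumes "left_stable M V" "t \<in> M" "v \<in> V"
  shows "poly_act t p v \<in> V"
  using assms
  by (induction p)
    (auto simp: left_stableD intro!: subspace_add subspace_scale subspace_0 dest: left_stable_subspace)

text \<open>If no nonzero polynomial killed \<open>v\<close>, the iterates \<open>L_t^i v\<close>
  would be independent, and there is no room for \<open>dim + 1\<close> of them.\<close>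

lemma annihilating_poly_vector: "\<exists>p. p \<noteq> 0 \<and> poly_act t p v = 0"
proof (rule ccontr)
  assume neg: "\<not> ?thesis"
  define S where "S k = (\<lambda>i. ((\<bullet>) t ^^ i) v) ` {..<k}" for k
  have notin: "((\<bullet>) t ^^ k) v \<notin> span (S k)" for k
  proof
    assume "((\<bullet>) t ^^ k) v \<in> span (S k)"
    \<comment> \<open>The span of the first \<open>k\<close> iterates consists of values of
      polynomials of degree below \<open>k\<close>; subtracting one from the monomial of degree
      \<open>k\<close> leaves coefficient 1 there.\<close>
    moreover have "\<exists>q. (\<forall>i\<ge>k. coeff q i = 0) \<and> poly_act t q v = x" if "x \<in> span (S k)" for x
      using that
    proof (induction rule: span_induct)
      case base
      show ?case
      proof (rule subspaceI, goal_cases)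
        case 1
        show ?case by (auto intro!: exI[of _ 0])
      next
        case (2 x y)
        then obtain p q where "\<forall>i\<ge>k. coeff p i = 0" "poly_act t p v = x"
          "\<forall>i\<ge>k. coeff q i = 0" "poly_act t q v = y" by auto
        then show ?case by (auto intro!: exI[of _ "p + q"] simp: poly_act_add)
      next
        case (3 c x)
        then obtain p where "\<forall>i\<ge>k. coeff p i = 0" "poly_act t p v = x" by auto
        then show ?case by (auto intro!: exI[of _ "smult c p"] simp: poly_act_smult)
      qed
    next
      case (step x)
      then obtain i where "i < k" "x = ((\<bullet>) t ^^ i) v" by (auto simp: S_def)
      then show ?case by (auto intro!: exI[of _ "monom 1 i"] simp: poly_act_monom)
    qed
    ultimately obtain q where q: "\<forall>i\<ge>k. coeff q i = 0" "poly_act t q v = ((\<bullet>) t ^^ k) v"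
      by blast
    have "coeff (monom 1 k + smult (-1) q) k = 1" using q by simp
    then have "monom 1 k + smult (-1) q \<noteq> 0" by (metis coeff_0 zero_neq_one)
    moreover have "poly_act t (monom 1 k + smult (-1) q) v = 0"
      by (simp only: poly_act_add poly_act_smult poly_act_monom q) simp
    ultimately show False using neg by blast
  qed
  have "independent (S k) \<and> card (S k) = k" for k
  proof (induction k)
    case 0
    show ?case by (simp add: S_def independent_empty)
  next
    case (Suc k)
    have "S (Suc k) = insert (((\<bullet>) t ^^ k) v) (S k)" by (simp add: S_def lessThan_Suc)
    moreover have "((\<bullet>) t ^^ k) v \<notin> S k" using notin span_base by blast
    moreover have "finite (S k)" by (simp add: S_def)
    ultimately show ?case using Suc notin by (simp add: independent_insert)
  qed
  then have "Suc (dim (UNIV :: 'a set)) \<le> dim (UNIV :: 'a set)"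
    using fd.independent_card_le_dim[of "S (Suc (dim (UNIV :: 'a set)))" UNIV] by simp
  then show False by simp
qed

text \<open>Polynomials in \<open>L_t\<close> commute, so the product of annihilators of the basis
  vectors kills every vector.\<close>

lemma annihilating_poly: "\<exists>p. p \<noteq> 0 \<and> (\<forall>v. poly_act t p v = 0)"
proof -
  have "\<exists>p. p \<noteq> 0 \<and> (\<forall>v\<in>S. poly_act t p v = 0)" if "finite S" for S
    using that
  proof (induction S)
    case empty
    show ?case by (auto intro: exI[of _ 1])
  next
    case (insert x S)
    then obtain p where p: "p \<noteq> 0" "\<forall>v\<in>S. poly_act t p v = 0" by auto
    obtain q where q: "q \<noteq> 0" "poly_act t q x = 0"
      using annihilating_poly_vector by blast
    have "poly_act t (q * p) v = 0" if "v \<in> S" for v using p that by (simp add: poly_act_mult)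
    moreover have "poly_act t (q * p) x = 0"
      using q by (subst mult.commute) (simp add: poly_act_mult)
    ultimately show ?case using p(1) q(1) by (intro exI[of _ "q * p"]) auto
  qed
  from this[OF fin_basis(1)] obtain p where p: "p \<noteq> 0" "\<forall>v\<in>fin_basis. poly_act t p v = 0" by auto
  have "poly_act t p v = 0" for v
  proof -
    have "v \<in> span fin_basis" using fin_basis by simp
    then show ?thesis
    proof (induction rule: span_induct)
      case base
      show ?case by (auto simp: subspace_def poly_act_add_right poly_act_scale_right)
    qed (use p in auto)
  qed
  then show ?thesis using p(1) by blast
qed

text \<open>If \<open>[L\<^sub>s, L\<^sub>t]\<close> commutes with \<open>L\<^sub>t\<close> and is invertible on \<open>V/W\<close>, then commuting with \<open>L\<^sub>s\<close>
  shows that the derivative of an annihilating polynomial of \<open>L\<^sub>t\<close> again annihilates \<open>V/W\<close>.\<close>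

lemma commutator_not_surj_mod:
  assumes char: "CHAR('f) = 0"
    and V: "left_stable {s, t} V" and W: "left_stable {s, t} W" and "\<not> V \<subseteq> W"
    and comm: "\<And>v. v \<in> V \<Longrightarrow> t \<bullet> ((s \<bullet> t) \<bullet> v) - (s \<bullet> t) \<bullet> (t \<bullet> v) \<in> W"
    and surj: "\<And>v. v \<in> V \<Longrightarrow> \<exists>u\<in>V. v - (s \<bullet> t) \<bullet> u \<in> W"
  shows False
proof -
  note sV = left_stable_subspace[OF V] and sW = left_stable_subspace[OF W]
  note act_V = poly_act_left_stable[OF V, of t] and act_W = poly_act_left_stable[OF W, of t]
  have b_V: "(s \<bullet> t) \<bullet> v \<in> V" if "v \<in> V" for v
    using left_stable_prdD[OF V _ _ that] by simp
  have b_act: "(s \<bullet> t) \<bullet> poly_act t p v - poly_act t p ((s \<bullet> t) \<bullet> v) \<in> W" if "v \<in> V" for p v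
  proof (induction p)
    case 0
    show ?case using sW by (simp add: subspace_0)
  next
    case (pCons a p)
    have "t \<bullet> ((s \<bullet> t) \<bullet> poly_act t p v - poly_act t p ((s \<bullet> t) \<bullet> v)) -
      (t \<bullet> ((s \<bullet> t) \<bullet> poly_act t p v) - (s \<bullet> t) \<bullet> (t \<bullet> poly_act t p v)) \<in> W"
      using that by (intro subspace_diff[OF sW] comm act_V left_stableD[OF W] pCons.IH) auto
    then show ?case by (simp add: prd_distribs)
  qed
  \<comment> \<open>This is \<open>[L_s, p(L_t)] = p'(L_t) [L_s, L_t]\<close> on \<open>V\<close>
    modulo \<open>W\<close>.\<close>
  have deriv: "s \<bullet> poly_act t p v - poly_act t p (s \<bullet> v) - poly_act t (pderiv p) ((s \<bullet> t) \<bullet> v) \<in> W"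
    if "v \<in> V" for p v
  proof (induction p)
    case 0
    show ?case using sW by (simp add: subspace_0)
  next
    case (pCons a p)
    have "t \<bullet> (s \<bullet> poly_act t p v - poly_act t p (s \<bullet> v) - poly_act t (pderiv p) ((s \<bullet> t) \<bullet> v))
      + ((s \<bullet> t) \<bullet> poly_act t p v - poly_act t p ((s \<bullet> t) \<bullet> v)) \<in> W"
      using that by (intro subspace_add[OF sW] b_act left_stableD[OF W] pCons.IH) auto
    then show ?case
      by (simp add: prd_distribs pderiv_pCons poly_act_add left_leibniz[of s t] algebra_simps)
  qed
  define P where "P p \<longleftrightarrow> p \<noteq> 0 \<and> (\<forall>v\<in>V. poly_act t p v \<in> W)" for p
  have "\<exists>p. P p" using annihilating_poly[of t] sW by (auto simp: P_def subspace_0)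
  then obtain p where p: "P p" and min: "\<And>q. P q \<Longrightarrow> degree p \<le> degree q"
    using ex_has_least_nat[where P = P and m = degree] by metis
  have "degree p \<noteq> 0"
  proof
    assume "degree p = 0"
    then obtain c where c: "p = [:c:]" by (rule degree_eq_zeroE)
    have "v \<in> W" if "v \<in> V" for v
      using p that subspace_scale[OF sW, of "c *s v" "inverse c"] by (auto simp: P_def c)
    then show False using \<open>\<not> V \<subseteq> W\<close> by auto
  qed
  then obtain d where d: "degree p = Suc d" by (cases "degree p") auto
  have "coeff (pderiv p) d = of_nat (Suc d) * coeff p (degree p)" by (simp add: coeff_pderiv d)
  also have "\<dots> \<noteq> 0"
    using char d of_nat_eq_0_iff_char_dvd[of "Suc d", where 'a = 'f] p leading_coeff_neq_0[of p]
    by (simp add: P_def del: of_nat_Suc leading_coeff_0_iff)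
  finally have "pderiv p \<noteq> 0" by auto
  \<comment> \<open>With \<open>v\<close> congruent to \<open>(s \<bullet> t) \<bullet> u\<close>,
    both terms with \<open>p\<close> in the commutator formula at \<open>u\<close> lie in
    \<open>W\<close>, which leaves the derivative term.\<close>
  moreover have "poly_act t (pderiv p) v \<in> W" if v: "v \<in> V" for v
  proof -
    obtain u where u: "u \<in> V" "v - (s \<bullet> t) \<bullet> u \<in> W" using surj v by blast
    have "s \<bullet> poly_act t p u \<in> W" "poly_act t p (s \<bullet> u) \<in> W"
      using p u left_stableD[OF W] left_stableD[OF V] by (auto simp: P_def)
    then have "poly_act t (pderiv p) ((s \<bullet> t) \<bullet> u) \<in> W"
      using subspace_diff[OF sW subspace_diff[OF sW] deriv[OF u(1), of p]] by force
    moreover have "poly_act t (pderiv p) (v - (s \<bullet> t) \<bullet> u) \<in> W" using u act_W by simp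
    ultimately have "poly_act t (pderiv p) ((s \<bullet> t) \<bullet> u + (v - (s \<bullet> t) \<bullet> u)) \<in> W"
      unfolding poly_act_add_right by (intro subspace_add[OF sW])
    then show ?thesis by simp
  qed
  ultimately have "P (pderiv p)" by (auto simp: P_def)
  from min[OF this] have "degree p \<le> degree (pderiv p)" .
  moreover have "degree (pderiv p) \<le> d"
    by (rule degree_le) (auto simp: coeff_pderiv d coeff_eq_0)
  ultimately show False using d by simp
qed

section \<open>Product spaces and derived series\<close>

lemma product_spaceI: "x \<in> U \<Longrightarrow> y \<in> V \<Longrightarrow> x \<bullet> y \<in> product_space U V"
  unfolding product_space_def by (rule span_base) blast

lemma subspace_product_space: "subspace (product_space U V)"
  by (simp add: product_space_def subspace_span)

lemma product_space_subset:
  assumes "subspace W" "\<And>x y. x \<in> U \<Longrightarrow> y \<in> V \<Longrightarrow> x \<bullet> y \<in> W"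
  shows "product_space U V \<subseteq> W"
  unfolding product_space_def using assms by (intro span_minimal) auto

lemma left_stable_product_space:
  assumes "\<And>x u. x \<in> M \<Longrightarrow> u \<in> U \<Longrightarrow> x \<bullet> u \<in> U" "\<And>x v. x \<in> M \<Longrightarrow> v \<in> V \<Longrightarrow> x \<bullet> v \<in> V"
  shows "left_stable M (product_space U V)"
  unfolding left_stable_def
proof (intro conjI ballI)
  fix x a assume x: "x \<in> M" and "a \<in> product_space U V"
  then have "a \<in> span {x \<bullet> y | x y. x \<in> U \<and> y \<in> V}" by (simp add: product_space_def)
  then show "x \<bullet> a \<in> product_space U V"
  proof (induction rule: span_induct)
    case base
    show ?case
      by (rule subspace_prd_right_preimage[OF subspace_product_space])
  next
    case (step a)
    then obtain u v where "a = u \<bullet> v" "u \<in> U" "v \<in> V" by auto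
    then show ?case
      using assms x unfolding \<open>a = u \<bullet> v\<close> left_leibniz[of x u v]
      by (intro subspace_add[OF subspace_product_space] product_spaceI)
  qed
qed (rule subspace_product_space)

text \<open>\<open>(u \<bullet> v) \<bullet> x = u \<bullet> (v \<bullet> x) - v \<bullet> (u
  \<bullet> x)\<close> exchanges the order of \<open>u\<close> and \<open>v\<close>, which is why
  both factors come from the same \<open>U\<close>.\<close>

lemma right_stable_product_space:
  assumes "\<And>x u. x \<in> M \<Longrightarrow> u \<in> U \<Longrightarrow> u \<bullet> x \<in> U" and "a \<in> product_space U U" and x: "x \<in> M"
  shows "a \<bullet> x \<in> product_space U U"
proof -
  have "a \<in> span {x \<bullet> y | x y. x \<in> U \<and> y \<in> U}" using assms(2) by (simp add: product_space_def)
  then show ?thesis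
  proof (induction rule: span_induct)
    case base
    show ?case
      by (rule subspace_prd_left_preimage[OF subspace_product_space])
  next
    case (step a)
    then obtain u v where "a = u \<bullet> v" "u \<in> U" "v \<in> U" by auto
    then show ?case
      using assms(1) x unfolding \<open>a = u \<bullet> v\<close> prd_prd_left
      by (intro subspace_diff[OF subspace_product_space] product_spaceI)
  qed
qed

lemma derived_series_mono: "U \<subseteq> V \<Longrightarrow> derived_series U k \<subseteq> derived_series V k"
proof (induction k)
  case (Suc k)
  then have "product_space (derived_series U k) (derived_series U k)
      \<subseteq> product_space (derived_series V k) (derived_series V k)"
    by (intro product_space_subset subspace_product_space product_spaceI) auto
  then show ?case by simp
qed simp

lemma left_stable_derived_series:
  assumes "subalgebra M"
  shows "left_stable M (derived_series M k)"
proof (induction k)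
  case 0
  show ?case using assms by (auto simp: left_stable_def subalgebra_def)
next
  case (Suc k)
  then show ?case by (auto intro!: left_stable_product_space simp: left_stableD)
qed

lemma right_stable_derived_series:
  assumes "subalgebra M" "x \<in> M" "a \<in> derived_series M k"
  shows "a \<bullet> x \<in> derived_series M k"
  using assms(3,2)
proof (induction k arbitrary: a x)
  case 0
  then show ?case using assms by (auto simp: subalgebra_def)
next
  case (Suc k)
  then show ?case using right_stable_product_space[of M "derived_series M k"] by auto
qed

lemma subalgebra_UNIV: "subalgebra UNIV"
  by (simp add: subalgebra_def)

text \<open>If \<open>L2\<close> acts nontrivially, the last derived term \<open>A\<close> acting
  nontrivially is a span of products. A product \<open>s \<bullet> t\<close> injective on
  \<open>V/W\<close> would also be surjective, which \<open>commutator_not_surj_mod\<close> excludes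
  once \<open>L_t\<close> commutes with \<open>L_(s \<bullet> t)\<close>.\<close>

lemma irr_factor_L2_trivial:
  assumes char: "CHAR('f) = 0" and solv: "solvable UNIV" and irr: "irr_factor UNIV V W"
    and x: "x \<in> L2" and v: "v \<in> V"
  shows "x \<bullet> v \<in> W"
proof (rule ccontr)
  assume contra: "x \<bullet> v \<notin> W"
  have V: "left_stable UNIV V" and W: "left_stable UNIV W" and "W \<subset> V"
    using irr by (auto simp: irr_factor_def)
  note sV = left_stable_subspace[OF V] and sW = left_stable_subspace[OF W]
  define D where "D = derived_series UNIV"
  define Q where "Q k \<longleftrightarrow> (\<forall>y\<in>D k. \<forall>v\<in>V. y \<bullet> v \<in> W)" for k
  have D_left: "y \<bullet> a \<in> D k" if "a \<in> D k" for y a k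
    using left_stable_derived_series[OF subalgebra_UNIV, of k] that by (simp add: D_def left_stableD)
  obtain k0 where "D k0 = {0}" using solv by (auto simp: solvable_def D_def)
  then have "Q k0" using sW by (auto simp: Q_def subspace_0)
  have "\<not> Q (Suc 0)" using contra x v by (auto simp: Q_def D_def)
  moreover have "\<not> Q 0" using contra v by (auto simp: Q_def D_def)
  define m where "m = (LEAST k. Q k)"
  have m: "Q m" unfolding m_def using \<open>Q k0\<close> by (rule LeastI)
  have less: "\<not> Q i" if "i < m" for i using that not_less_Least unfolding m_def by blast
  have "m \<noteq> 0" "m \<noteq> Suc 0" using m \<open>\<not> Q 0\<close> \<open>\<not> Q (Suc 0)\<close> by metis+
  \<comment> \<open>As the term of index 1 acts nontrivially, \<open>m\<close> is at least 2; so
    \<open>A\<close>, one step before \<open>m\<close>, is the product of \<open>D k\<close> with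
    itself.\<close>
  then obtain k where k: "m = Suc (Suc k)" by (metis not0_implies_Suc)
  define A where "A = D (Suc k)"
  have notA: "\<not> (\<forall>y\<in>A. \<forall>v\<in>V. y \<bullet> v \<in> W)" using less[of "Suc k"] k by (simp add: Q_def A_def)
  have AA: "(a \<bullet> b) \<bullet> v \<in> W" if "a \<in> A" "b \<in> A" "v \<in> V" for a b v
    using m that by (auto simp: k Q_def D_def A_def product_spaceI)
  have not_inj: False if inj: "\<And>v. v \<in> V \<Longrightarrow> (s \<bullet> t) \<bullet> v \<in> W \<Longrightarrow> v \<in> W"
      and comm: "\<And>v. v \<in> V \<Longrightarrow> t \<bullet> ((s \<bullet> t) \<bullet> v) - (s \<bullet> t) \<bullet> (t \<bullet> v) \<in> W" for s t
  proof (rule commutator_not_surj_mod[OF char _ _ _ comm])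
    show "left_stable {s, t} V" "left_stable {s, t} W" "\<not> V \<subseteq> W"
      using V W \<open>W \<subset> V\<close> by (auto simp: left_stable_def)
    have "left_stable {s \<bullet> t} V" "left_stable {s \<bullet> t} W"
      using V W by (auto simp: left_stable_def)
    then show "\<exists>u\<in>V. v - (s \<bullet> t) \<bullet> u \<in> W" if "v \<in> V" for v
      using surj_mod_of_inj_mod[of "s \<bullet> t" V W v] that inj psubset_imp_subset[OF \<open>W \<subset> V\<close>]
      by metis
  qed
  \<comment> \<open>First \<open>[L, A]\<close> acts trivially on \<open>V/W\<close>, so \<open>A\<close> acts centrally; then \<open>A = [B, B]\<close> itself does.\<close>
  define G where "G = {s \<bullet> a | s a. s \<in> UNIV \<and> a \<in> A}"
  have spG: "span G = product_space UNIV A" by (simp add: product_space_def G_def)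
  have GA: "span G \<subseteq> A"
    unfolding spG using left_stable_derived_series[OF subalgebra_UNIV, of "Suc k"]
    by (intro product_space_subset) (auto simp only: A_def D_def left_stable_def)
  have "(\<forall>x\<in>span G. \<forall>v\<in>V. x \<bullet> v \<in> W) \<or> (\<exists>x\<in>G. \<forall>v\<in>V. x \<bullet> v \<in> W \<longrightarrow> v \<in> W)"
  proof (rule irr_factor_trivial_or_inj[OF irr])
    show "y \<bullet> x \<in> span G" if "x \<in> span G" for x y
      using that left_stable_product_space[of UNIV UNIV A] D_left
      unfolding spG by (auto simp: A_def left_stableD)
  qed (use AA GA in auto)
  moreover have "\<not> (\<exists>x\<in>G. \<forall>v\<in>V. x \<bullet> v \<in> W \<longrightarrow> v \<in> W)"
  proof
    assume "\<exists>x\<in>G. \<forall>v\<in>V. x \<bullet> v \<in> W \<longrightarrow> v \<in> W"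
    then obtain s a where a: "a \<in> A" "\<And>v. v \<in> V \<Longrightarrow> (s \<bullet> a) \<bullet> v \<in> W \<Longrightarrow> v \<in> W"
      by (auto simp: G_def)
    \<comment> \<open>\<open>a\<close> and \<open>s \<bullet> a\<close> both lie in
      \<open>A\<close>, whose products act as zero.\<close>
    have "a \<bullet> ((s \<bullet> a) \<bullet> v) - (s \<bullet> a) \<bullet> (a \<bullet> v) \<in> W" if "v \<in> V" for v
      using AA[OF a(1) _ that, of "s \<bullet> a"] a(1) D_left[of a "Suc k" s] by (simp add: A_def prd_prd_left)
    then show False using not_inj[of s a] a(2) by blast
  qed
  ultimately have central: "(s \<bullet> a) \<bullet> v \<in> W" if "a \<in> A" "v \<in> V" for s a v
    using that span_base[of "s \<bullet> a" G] by (auto simp: G_def)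
  \<comment> \<open>Here \<open>t\<close> lies in \<open>D k\<close>, possibly outside
    \<open>A\<close>, so commutation of \<open>L_t\<close> with \<open>L_(s \<bullet> t)\<close>
    cannot come from \<open>AA\<close>; it comes from \<open>central\<close>.\<close>
  define H where "H = {s \<bullet> t | s t. s \<in> D k \<and> t \<in> D k}"
  have spH: "span H = A" by (simp add: A_def D_def H_def product_space_def)
  have "(\<forall>x\<in>span H. \<forall>v\<in>V. x \<bullet> v \<in> W) \<or> (\<exists>x\<in>H. \<forall>v\<in>V. x \<bullet> v \<in> W \<longrightarrow> v \<in> W)"
    by (rule irr_factor_trivial_or_inj[OF irr]) (use spH AA D_left in \<open>auto simp: A_def\<close>)
  with notA spH obtain s t where st: "s \<bullet> t \<in> H" "\<And>v. v \<in> V \<Longrightarrow> (s \<bullet> t) \<bullet> v \<in> W \<Longrightarrow> v \<in> W"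
    by (auto simp: H_def)
  have "s \<bullet> t \<in> A" using st(1) spH span_base by blast
  then have "t \<bullet> ((s \<bullet> t) \<bullet> v) - (s \<bullet> t) \<bullet> (t \<bullet> v) \<in> W" if "v \<in> V" for v
    using central[of "s \<bullet> t" v t] that by (simp add: prd_prd_left[of t])
  then show False using not_inj[of s t] st(2) by blast
qed

text \<open>Along a composition series of \<open>L\<close> as a left module, \<open>x\<close> maps
  each term into the next, so every factor costs one more power of \<open>L_x\<close>.\<close>

lemma left_mult_nilpotent:
  assumes char: "CHAR('f) = 0" and solv: "solvable UNIV" and x: "x \<in> L2"
  shows "\<exists>N. \<forall>v. ((\<bullet>) x ^^ N) v = 0"
proof -
  have "\<exists>N. \<forall>v\<in>V. ((\<bullet>) x ^^ N) v = 0" if "left_stable UNIV V" for V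
    using that
  proof (induction "dim V" arbitrary: V rule: less_induct)
    case less
    note sV = left_stable_subspace[OF less.prems]
    show ?case
    proof (cases "V = {0}")
      case False
      define P where "P W \<longleftrightarrow> left_stable UNIV W \<and> W \<subset> V" for W
      have "P {0}" using False sV subspace_0 by (auto simp: P_def left_stable_def subspace_single_0)
      then obtain W where W: "P W" and max: "\<And>J. P J \<Longrightarrow> W \<subseteq> J \<Longrightarrow> J = W"
        by (rule finite_dim_maximal[of P "{0}"]) (auto simp: P_def left_stable_subspace)
      have irr: "irr_factor UNIV V W"
        using W max less.prems by (auto simp: irr_factor_def P_def)
      have "dim W < dim V"
        using W sV fd.subspace_dim_equal[of W V] by (auto simp: P_def left_stable_subspace not_less[symmetric])
      then obtain N where N: "\<And>v. v \<in> W \<Longrightarrow> ((\<bullet>) x ^^ N) v = 0"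
        using less.hyps[of W] W unfolding P_def by blast
      have "((\<bullet>) x ^^ Suc N) v = 0" if "v \<in> V" for v
        using N[OF irr_factor_L2_trivial[OF char solv irr x that]] by (simp add: funpow_swap1)
      then show ?thesis by blast
    qed (auto intro: exI[of _ 0])
  qed
  from this[of UNIV] show ?thesis by (simp add: left_stable_def)
qed

subsection \<open>Exponentials\<close>

lemma prd_sum_right: "x \<bullet> sum f S = (\<Sum>i\<in>S. x \<bullet> f i)"
  by (induction S rule: infinite_finite_induct) (auto simp: prd_add_right)

lemma prd_sum_left: "sum f S \<bullet> x = (\<Sum>i\<in>S. f i \<bullet> x)"
  by (induction S rule: infinite_finite_induct) (auto simp: prd_add_left)

lemma pow_sum: "((\<bullet>) x ^^ k) (sum f S) = (\<Sum>i\<in>S. ((\<bullet>) x ^^ k) (f i))"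
  by (induction S rule: infinite_finite_induct) (auto simp: pow_add)

lemma pow_prd:
  "((\<bullet>) x ^^ n) (a \<bullet> b) =
    (\<Sum>i\<le>n. of_nat (n choose i) *s (((\<bullet>) x ^^ i) a \<bullet> ((\<bullet>) x ^^ (n - i)) b))"
proof (induction n)
  case (Suc n)
  define f where "f i j = ((\<bullet>) x ^^ i) a \<bullet> ((\<bullet>) x ^^ j) b" for i j
  have xf: "x \<bullet> f i j = f (Suc i) j + f i (Suc j)" for i j
    by (simp add: f_def left_leibniz[of x "((\<bullet>) x ^^ i) a"])
  have shift: "(\<Sum>i\<le>n. of_nat (n choose i) *s f i (Suc (n - i))) =
    f 0 (Suc n) + (\<Sum>i\<le>n. of_nat (n choose Suc i) *s f (Suc i) (n - i))"
  proof -
    have "(\<Sum>i\<le>n. of_nat (n choose i) *s f i (Suc (n - i))) =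
      (\<Sum>i\<le>Suc n. of_nat (n choose i) *s f i (Suc n - i))"
      by (simp add: Suc_diff_le binomial_eq_0)
    also have "\<dots> = f 0 (Suc n) + (\<Sum>i\<le>n. of_nat (n choose Suc i) *s f (Suc i) (n - i))"
      by (subst sum.atMost_Suc_shift) simp
    finally show ?thesis .
  qed
  have "((\<bullet>) x ^^ Suc n) (a \<bullet> b) = (\<Sum>i\<le>n. of_nat (n choose i) *s (x \<bullet> f i (n - i)))"
    using Suc by (simp add: prd_sum_right prd_scale_right f_def)
  also have "\<dots> = (\<Sum>i\<le>n. of_nat (n choose i) *s f (Suc i) (n - i)) +
      (\<Sum>i\<le>n. of_nat (n choose i) *s f i (Suc (n - i)))"
    by (simp add: xf scale_right_distrib sum.distrib)
  also have "\<dots> = f 0 (Suc n) + (\<Sum>i\<le>n. of_nat (Suc n choose Suc i) *s f (Suc i) (n - i))"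
    by (simp add: shift scale_left_distrib sum.distrib algebra_simps)
  also have "\<dots> = (\<Sum>i\<le>Suc n. of_nat (Suc n choose i) *s f i (Suc n - i))"
    by (subst sum.atMost_Suc_shift) simp
  finally show ?case by (simp only: f_def)
qed simp

text \<open>Truncating at \<open>N\<close> loses nothing in products: the second clause is automatic from
  \<open>L\<^sub>x\<^sup>k = 0\<close> and \<open>N \<ge> 2 k\<close>, but in characteristic \<open>p\<close> one needs \<open>N \<le> p\<close>.\<close>

definition exp_bound :: "nat \<Rightarrow> 'a \<Rightarrow> bool" where
  "exp_bound N x \<longleftrightarrow> (\<forall>v. ((\<bullet>) x ^^ N) v = 0) \<and>
     (\<forall>i j a b. N \<le> i + j \<longrightarrow> ((\<bullet>) x ^^ i) a \<bullet> ((\<bullet>) x ^^ j) b = 0) \<and>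
     (\<forall>r<N. of_nat (fact r) \<noteq> (0 :: 'f))"

text \<open>The terms added up to \<open>N\<close> vanish through the powers of \<open>L_x\<close>,
  whatever \<open>1 / of_nat (fact r)\<close> is; hence \<open>N\<close> may be enlarged even past
  the characteristic.\<close>

lemma exp_L_eq_sum:
  assumes "\<And>v. ((\<bullet>) x ^^ N) v = 0"
  shows "exp_L x y = (\<Sum>r<N. (1 / of_nat (fact r)) *s ((\<bullet>) x ^^ r) y)"
proof -
  have zero: "((\<bullet>) x ^^ r) v = 0" if "N \<le> r" for r v
  proof -
    have "((\<bullet>) x ^^ r) v = ((\<bullet>) x ^^ (r - N)) (((\<bullet>) x ^^ N) v)"
      using that by (metis comp_apply funpow_add le_add_diff_inverse2)
    then show ?thesis using assms by simp
  qed
  then have "{r. ((\<bullet>) x ^^ r) \<noteq> (\<lambda>_. 0)} \<subseteq> {..<N}"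
    by (auto simp: fun_eq_iff not_le[symmetric])
  then show ?thesis
    unfolding exp_L_def by (intro sum.mono_neutral_left) (auto simp: fun_eq_iff)
qed

lemma exp_L_eq: "exp_bound N x \<Longrightarrow> exp_L x y = (\<Sum>r<N. (1 / of_nat (fact r)) *s ((\<bullet>) x ^^ r) y)"
  by (rule exp_L_eq_sum) (simp add: exp_bound_def)

lemma exp_L_add: "exp_bound N x \<Longrightarrow> exp_L x (y + z) = exp_L x y + exp_L x z"
  by (simp add: exp_L_eq pow_add scale_right_distrib sum.distrib)

lemma exp_L_scale: "exp_bound N x \<Longrightarrow> exp_L x (c *s y) = c *s exp_L x y"
  by (simp add: exp_L_eq pow_scale scale_sum_right mult.commute)

lemma exp_L_prd:
  assumes N: "exp_bound N x"
  shows "exp_L x (a \<bullet> b) = exp_L x a \<bullet> exp_L x b"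
proof -
  define f where "f i = (1 / of_nat (fact i) :: 'f)" for i
  define g where "g i j = (f i * f j) *s (((\<bullet>) x ^^ i) a \<bullet> ((\<bullet>) x ^^ j) b)" for i j
  have coef: "f n * of_nat (n choose i) = f i * f (n - i)" if "n < N" "i \<le> n" for n i
  proof -
    have "of_nat (fact i) * of_nat (fact (n - i)) * of_nat (n choose i) = (of_nat (fact n) :: 'f)"
      using binomial_fact_lemma[OF that(2)] by (metis of_nat_mult)
    moreover have "of_nat (fact i) \<noteq> (0::'f)" "of_nat (fact (n - i)) \<noteq> (0::'f)"
      "of_nat (fact n) \<noteq> (0::'f)"
      using N that by (auto simp: exp_bound_def simp del: of_nat_fact)
    ultimately show ?thesis by (simp add: f_def field_simps del: of_nat_fact)
  qed
  have "exp_L x (a \<bullet> b) = (\<Sum>n<N. \<Sum>i\<le>n. g i (n - i))"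
    unfolding exp_L_eq[OF N] pow_prd scale_sum_right
    by (intro sum.cong refl) (auto simp: g_def coef simp flip: f_def)
  also have "\<dots> = (\<Sum>(i, j)\<in>{(i, j). i + j < N}. g i j)"
    by (rule sum.triangle_reindex[symmetric])
  \<comment> \<open>Terms with \<open>i + j\<close> at least \<open>N\<close> are zero by
    \<open>exp_bound\<close>, so the triangle may be completed to the square.\<close>
  also have "\<dots> = (\<Sum>(i, j)\<in>{..<N} \<times> {..<N}. g i j)"
  proof (rule sum.mono_neutral_left)
    have "g i j = 0" if "\<not> i + j < N" for i j
      using N that unfolding g_def exp_bound_def not_less by simp
    then show "\<forall>p\<in>{..<N} \<times> {..<N} - {(i, j). i + j < N}. (case p of (i, j) \<Rightarrow> g i j) = 0"
      by auto
  qed auto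
  also have "\<dots> = (\<Sum>i<N. \<Sum>j<N. g i j)"
    by (simp add: sum.cartesian_product)
  also have "\<dots> = exp_L x a \<bullet> exp_L x b"
    unfolding exp_L_eq[OF N] prd_sum_left
    by (simp add: g_def f_def prd_sum_right prd_scale_left prd_scale_right mult.commute)
  finally show ?thesis .
qed

lemma exp_L_fixed:
  assumes N: "exp_bound N x" and "x \<bullet> z = 0"
  shows "exp_L x z = z"
proof (cases N)
  case 0
  \<comment> \<open>\<open>N = 0\<close> says that \<open>L_x^0\<close>, the identity, is zero; then
    the whole space is zero.\<close>
  then have zero: "((\<bullet>) x ^^ 0) v = 0" for v using N unfolding exp_bound_def by blast
  from zero[of z] zero[of "exp_L x z"] show ?thesis by simp
next
  case (Suc n)
  have "((\<bullet>) x ^^ Suc r) z = 0" for r using assms(2) by (simp add: funpow_Suc_right del: funpow.simps)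
  then show ?thesis unfolding exp_L_eq[OF N] Suc by (subst sum.lessThan_Suc_shift) simp
qed

lemma exp_L_pow_commute:
  assumes "exp_bound N x"
  shows "((\<bullet>) x ^^ k) (exp_L x y) = exp_L x (((\<bullet>) x ^^ k) y)"
  by (simp add: exp_L_eq[OF assms] pow_sum pow_scale funpow_add[symmetric, THEN fun_cong, simplified] add.commute)

lemma exp_L_left_stable:
  assumes N: "exp_bound N x" and I: "left_stable {x} I" and "y \<in> I"
  shows "exp_L x y \<in> I"
  using pow_left_stable[OF I _ \<open>y \<in> I\<close>] left_stable_subspace[OF I]
  by (auto simp: exp_L_eq[OF N] intro!: subspace_sum subspace_scale)

text \<open>If \<open>L_x^(k+1) y = 0\<close>, then \<open>exp(L_x)\<close> fixes
  \<open>L_x^k y\<close>, so \<open>L_x^k\<close> kills \<open>y - exp(L_x) y\<close>. By induction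
  this difference is some \<open>exp(L_x) z\<close>, and \<open>y + z\<close> is a preimage of
  \<open>y\<close>.\<close>

lemma exp_L_image:
  assumes N: "exp_bound N x" and I: "left_stable {x} I"
  shows "exp_L x ` I = I"
proof
  show "exp_L x ` I \<subseteq> I" using exp_L_left_stable[OF assms] by auto
  have "y \<in> exp_L x ` I" if "y \<in> I" "((\<bullet>) x ^^ k) y = 0" for y k
    using that
  proof (induction k arbitrary: y)
    case 0
    then have "exp_L x y = y" by (intro exp_L_fixed[OF N]) simp
    then show ?case using 0 by force
  next
    case (Suc k)
    have "exp_L x (((\<bullet>) x ^^ k) y) = ((\<bullet>) x ^^ k) y"
      using Suc.prems by (intro exp_L_fixed[OF N]) simp
    then have "((\<bullet>) x ^^ k) (y - exp_L x y) = 0"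
      by (simp add: pow_diff exp_L_pow_commute[OF N])
    moreover have "y - exp_L x y \<in> I"
      using exp_L_left_stable[OF assms] Suc.prems left_stable_subspace[OF I]
      by (auto intro: subspace_diff)
    ultimately obtain z where z: "z \<in> I" "y - exp_L x y = exp_L x z" using Suc.IH by blast
    then have "y = exp_L x (y + z)" using exp_L_add[OF N, of y z] by (simp add: algebra_simps)
    moreover have "y + z \<in> I"
      using z Suc.prems left_stable_subspace[OF I] by (auto intro: subspace_add)
    ultimately show ?case by blast
  qed
  then show "I \<subseteq> exp_L x ` I" using N unfolding exp_bound_def by blast
qed

text \<open>If \<open>L_x^(k+1) y = 0\<close>, then
  \<open>L_x^k y = exp(L_x) (L_x^k y) = L_x^k (exp(L_x) y) = 0\<close>, so the exponent descends to
  zero.\<close>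

lemma exp_L_eq_0:
  assumes N: "exp_bound N x" and "exp_L x y = 0"
  shows "y = 0"
proof -
  have "((\<bullet>) x ^^ k) y = 0 \<Longrightarrow> y = 0" for k
  proof (induction k)
    case (Suc k)
    have "((\<bullet>) x ^^ k) y = exp_L x (((\<bullet>) x ^^ k) y)"
      using Suc.prems by (intro exp_L_fixed[OF N, symmetric]) simp
    also have "\<dots> = 0" using exp_L_pow_commute[OF N, of k y] assms(2) by simp
    finally show ?case by (rule Suc.IH)
  qed simp
  then show ?thesis using N unfolding exp_bound_def by blast
qed

lemma automorphism_exp_L:
  assumes N: "exp_bound N x"
  shows "automorphism (exp_L x)"
proof -
  have "Vector_Spaces.linear scale scale (exp_L x)"
    using exp_L_add[OF N] exp_L_scale[OF N]
    by unfold_locales auto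
  moreover have "inj (exp_L x)"
  proof (rule injI)
    fix y z assume "exp_L x y = exp_L x z"
    then have "exp_L x (y - z) = 0"
      using exp_L_add[OF N, of "y - z" z] by simp
    then show "y = z" using exp_L_eq_0[OF N] by force
  qed
  moreover have "surj (exp_L x)"
    using exp_L_image[OF N, of UNIV] by (auto simp: left_stable_def)
  ultimately show ?thesis using exp_L_prd[OF N] by (auto simp: automorphism_def bij_def)
qed

text \<open>Without the index shift this is \<open>U^(i+1) U^(j+1) \<subseteq> U^(i+j+2)\<close>.
  Induction on \<open>i\<close> uses \<open>(x \<bullet> y) \<bullet> v = x \<bullet> (y \<bullet>
  v) - y \<bullet> (x \<bullet> v)\<close>; the second term raises \<open>j\<close>, which must
  therefore vary.\<close>

lemma lower_central_series_prd:
  assumes "u \<in> lower_central_series U i" "v \<in> lower_central_series U j"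
  shows "u \<bullet> v \<in> lower_central_series U (Suc (i + j))"
  using assms
proof (induction i arbitrary: u v j)
  case 0
  then show ?case by (simp add: product_spaceI)
next
  case (Suc i)
  have sub: "subspace (lower_central_series U (Suc k))" for k by (simp add: subspace_product_space)
  have "u \<in> span {x \<bullet> y | x y. x \<in> U \<and> y \<in> lower_central_series U i}"
    using Suc.prems by (simp add: product_space_def)
  then show ?case
  proof (induction rule: span_induct)
    case base
    show ?case
      by (rule subspace_prd_left_preimage[OF sub])
  next
    case (step u)
    then obtain x y where u: "u = x \<bullet> y" and x: "x \<in> U" and y: "y \<in> lower_central_series U i"
      by auto
    have "x \<bullet> (y \<bullet> v) \<in> lower_central_series U (Suc (Suc i + j))"
      using Suc.IH[OF y Suc.prems(2)] x by (simp add: product_spaceI)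
    moreover have "x \<bullet> v \<in> lower_central_series U (Suc j)"
      using x Suc.prems(2) by (simp add: product_spaceI)
    then have "y \<bullet> (x \<bullet> v) \<in> lower_central_series U (Suc (Suc i + j))"
      using Suc.IH[OF y, of "x \<bullet> v" "Suc j"] by simp
    ultimately show ?case unfolding u prd_prd_left by (intro subspace_diff[OF sub])
  qed
qed

lemma lower_central_series_zero_mono:
  assumes "lower_central_series U c = {0}" "c \<le> k"
  shows "lower_central_series U k \<subseteq> {0}"
  using assms(2)
proof (induction k rule: dec_induct)
  case base
  then show ?case using assms(1) by simp
next
  case (step k)
  have "product_space U (lower_central_series U k) \<subseteq> {0}"
  proof (rule product_space_subset)
    show "x \<bullet> y \<in> {0}" if "y \<in> lower_central_series U k" for x y
      using step.IH that by auto
  qed (rule subspace_single_0)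
  then show ?case by simp
qed

text \<open>The first application only enters \<open>L2\<close>, which has index 0; hence
  \<open>Suc k\<close> powers for index \<open>k\<close>.\<close>

lemma pow_L2_lower_central_series:
  assumes "x \<in> L2"
  shows "((\<bullet>) x ^^ Suc k) v \<in> lower_central_series L2 k"
proof (induction k)
  case 0
  show ?case by (simp add: product_spaceI)
next
  case (Suc k)
  then show ?case using assms by (simp add: product_spaceI)
qed

text \<open>Let \<open>c\<close> be the class. For \<open>i, j > 0\<close> the two factors have
  indices \<open>i - 1\<close> and \<open>j - 1\<close>, so their product has index
  \<open>i + j - 1\<close>, which is at least \<open>c\<close> once \<open>i + j\<close> reaches
  \<open>c + 1\<close>. The bound \<open>c < p\<close> keeps the factorials up to \<open>c!\<close>
  nonzero.\<close>

lemma exp_bound_char_p: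
  assumes p: "CHAR('f) > 0" and nil: "nilpotent L2" and "nilpotency_class L2 < CHAR('f)"
    and x: "x \<in> L2"
  shows "exp_bound (Suc (nilpotency_class L2)) x"
proof -
  define c where "c = nilpotency_class L2"
  have c: "lower_central_series L2 c = {0}"
    using nil unfolding c_def nilpotency_class_def nilpotent_def by (rule LeastI_ex)
  have zero: "((\<bullet>) x ^^ r) v = 0" if "Suc c \<le> r" for r v
  proof -
    have "r = Suc (r - 1)" "c \<le> r - 1" using that by simp_all
    then show ?thesis
      using pow_L2_lower_central_series[OF x, of "r - 1" v] lower_central_series_zero_mono[OF c, of "r - 1"]
      by auto
  qed
  have "((\<bullet>) x ^^ i) a \<bullet> ((\<bullet>) x ^^ j) b = 0" if "Suc c \<le> i + j" for i j a b
  proof (cases "i = 0 \<or> j = 0")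
    case True
    then show ?thesis using that zero by auto
  next
    case False
    then obtain k l where kl: "i = Suc k" "j = Suc l" by (metis not0_implies_Suc)
    then have "((\<bullet>) x ^^ i) a \<bullet> ((\<bullet>) x ^^ j) b \<in> lower_central_series L2 (Suc (k + l))"
      using lower_central_series_prd pow_L2_lower_central_series[OF x] by blast
    then show ?thesis using lower_central_series_zero_mono[OF c, of "Suc (k + l)"] that kl by auto
  qed
  moreover have "of_nat (fact r) \<noteq> (0 :: 'f)" if "r < Suc c" for r
  proof -
    have "prime CHAR('f)" using p by (rule prime_CHAR_semidom)
    then show ?thesis
      using that assms(3) by (simp add: of_nat_eq_0_iff_char_dvd prime_dvd_fact_iff c_def del: of_nat_fact)
  qed
  ultimately show ?thesis
    using zero[of "Suc c"] unfolding exp_bound_def c_def by (simp del: funpow.simps of_nat_fact)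
qed

lemma exp_bound_char_0:
  assumes char: "CHAR('f) = 0" and solv: "solvable UNIV" and x: "x \<in> L2"
  obtains N where "exp_bound N x"
proof -
  obtain k where k: "\<And>v. ((\<bullet>) x ^^ k) v = 0" using left_mult_nilpotent[OF assms] by blast
  have zero: "((\<bullet>) x ^^ r) v = 0" if "k \<le> r" for r v
    using k that pow_left_stable_mono[of "{x}" "{0}" x k v r]
    by (auto simp: left_stable_def subspace_single_0)
  have "((\<bullet>) x ^^ i) a \<bullet> ((\<bullet>) x ^^ j) b = 0" if "2 * k \<le> i + j" for i j a b
  proof -
    have "k \<le> i \<or> k \<le> j" using that by linarith
    then show ?thesis using zero by auto
  qed
  moreover have "of_nat (fact r) \<noteq> (0 :: 'f)" for r
    using char by (simp add: of_nat_eq_0_iff_char_dvd del: of_nat_fact)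
  ultimately have "exp_bound (2 * k) x" using zero by (auto simp: exp_bound_def simp del: of_nat_fact)
  then show ?thesis by (rule that)
qed

subsection \<open>Inner automorphisms fix all ideals\<close>

lemma group_Aut: "group Aut"
proof (rule groupI)
  show "f \<otimes>\<^bsub>Aut\<^esub> g \<in> carrier Aut" if "f \<in> carrier Aut" "g \<in> carrier Aut" for f g
    using that by (auto simp: Aut_def automorphism_def bij_comp intro: Vector_Spaces.linear_compose)
  show "\<one>\<^bsub>Aut\<^esub> \<in> carrier Aut"
    using bij_id by (auto simp: Aut_def automorphism_def linear_id)
  show "\<exists>g\<in>carrier Aut. g \<otimes>\<^bsub>Aut\<^esub> f = \<one>\<^bsub>Aut\<^esub>" if "f \<in> carrier Aut" for f
  proof (rule bexI)
    have f: "Vector_Spaces.linear scale scale f" "bij f" "\<And>x y. f (x \<bullet> y) = f x \<bullet> f y"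
      using that by (auto simp: Aut_def automorphism_def)
    interpret f: Vector_Spaces.linear scale scale f by (rule f)
    have surj: "f (inv_into UNIV f x) = x" and inj: "inv_into UNIV f (f x) = x" for x
      using f(2) by (auto simp: bij_def surj_f_inv_f)
    have "Vector_Spaces.linear scale scale (inv_into UNIV f)"
    proof unfold_locales
      show "inv_into UNIV f (x + y) = inv_into UNIV f x + inv_into UNIV f y" for x y
        using inj[of "inv_into UNIV f x + inv_into UNIV f y"] by (simp add: f.add surj)
      show "inv_into UNIV f (c *s x) = c *s inv_into UNIV f x" for c x
        using inj[of "c *s inv_into UNIV f x"] by (simp add: f.scale surj)
    qed
    moreover have "inv_into UNIV f (x \<bullet> y) = inv_into UNIV f x \<bullet> inv_into UNIV f y" for x y
      using inj[of "inv_into UNIV f x \<bullet> inv_into UNIV f y"] by (simp add: f(3) surj)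
    ultimately show "inv_into UNIV f \<in> carrier Aut"
      using f(2) by (auto simp: Aut_def automorphism_def bij_imp_bij_inv)
    show "inv_into UNIV f \<otimes>\<^bsub>Aut\<^esub> f = \<one>\<^bsub>Aut\<^esub>"
      using inj by (auto simp: Aut_def fun_eq_iff)
  qed
qed (auto simp: Aut_def comp_assoc)

text \<open>That generators map each ideal onto itself, not merely into itself, is what passes to
  inverses and hence to the generated group.\<close>

lemma inner_Aut_ideal:
  assumes bound: "\<And>x. x \<in> L2 \<Longrightarrow> \<exists>N. exp_bound N x" and "f \<in> inner_Aut"
  shows "automorphism f \<and> (\<forall>I. ideal I \<longrightarrow> f ` I = I)"
proof -
  interpret Aut: group Aut by (rule group_Aut)
  have gen: "exp_L x \<in> carrier Aut \<and> (\<forall>I. ideal I \<longrightarrow> exp_L x ` I = I)" if x: "x \<in> L2" for x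
  proof -
    obtain N where N: "exp_bound N x" using bound x by blast
    show ?thesis
      using automorphism_exp_L[OF N] exp_L_image[OF N]
      by (auto simp: Aut_def ideal_def left_stable_def)
  qed
  have "f \<in> carrier Aut \<and> (\<forall>I. ideal I \<longrightarrow> f ` I = I)"
    using assms(2) unfolding inner_Aut_def
  proof (induction rule: generate.induct)
    case one
    show ?case using Aut.one_closed by (auto simp: Aut_def id_def)
  next
    case (incl h)
    then show ?case using gen by auto
  next
    case (inv h)
    then have h: "h \<in> carrier Aut" "\<And>I. ideal I \<Longrightarrow> h ` I = I" using gen by auto
    have "inv\<^bsub>Aut\<^esub> h \<circ> h = id" using Aut.l_inv[OF h(1)] by (simp add: Aut_def)
    then have "(inv\<^bsub>Aut\<^esub> h) ` I = I" if "ideal I" for I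
      using h(2)[OF that] by (metis image_comp image_id id_apply)
    then show ?case using Aut.inv_closed[OF h(1)] by blast
  next
    case (eng h1 h2)
    then have "(h1 \<circ> h2) ` I = I" if "ideal I" for I
      using that by (metis image_comp)
    then have "(h1 \<otimes>\<^bsub>Aut\<^esub> h2) ` I = I" if "ideal I" for I
      using that by (simp add: Aut_def)
    moreover have "h1 \<otimes>\<^bsub>Aut\<^esub> h2 \<in> carrier Aut" using eng by (intro Aut.m_closed) blast+
    ultimately show ?case by blast
  qed
  then show ?thesis by (simp add: Aut_def)
qed

lemma core_eq_of_conjugate:
  assumes bound: "\<And>x. x \<in> L2 \<Longrightarrow> \<exists>N. exp_bound N x"
    and M: "subspace M" and K: "subspace K" and conj: "conjugate inner_Aut M K"
  shows "core M = core K"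
proof -
  obtain f where f: "f \<in> inner_Aut" "f ` M = K" using conj by (auto simp: conjugate_def)
  have fI: "\<And>I. ideal I \<Longrightarrow> f ` I = I" and "inj f"
    using inner_Aut_ideal[OF bound f(1)] by (auto simp: automorphism_def bij_def)
  have "core M \<subseteq> core K"
    using core_greatest(1,2)[OF M] fI f(2) by (intro core_greatest(3)[OF K]) blast+
  \<comment> \<open>The reverse inclusion cancels \<open>f\<close> instead of inverting it:
    \<open>core K\<close> is its own image and lies in the image of \<open>M\<close>.\<close>
  moreover have "f ` core K \<subseteq> f ` M"
    using core_greatest(1,2)[OF K] fI f(2) by auto
  then have "core K \<subseteq> M" using \<open>inj f\<close> by (simp add: inj_image_subset_iff)
  then have "core K \<subseteq> core M"
    using core_greatest(1)[OF K] by (intro core_greatest(3)[OF M])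
  ultimately show ?thesis by (rule subset_antisym)
qed

subsection \<open>Chief factors and maximal subalgebras\<close>

definition chief_factor :: "'a set \<Rightarrow> 'a set \<Rightarrow> bool" where
  "chief_factor A I \<longleftrightarrow> ideal A \<and> ideal I \<and> I \<subset> A \<and>
     (\<forall>J. ideal J \<longrightarrow> I \<subseteq> J \<longrightarrow> J \<subseteq> A \<longrightarrow> J = I \<or> J = A)"

lemma ideal_subspace: "ideal I \<Longrightarrow> subspace I"
  by (simp add: ideal_def)

lemma ideal_left: "ideal I \<Longrightarrow> a \<in> I \<Longrightarrow> x \<bullet> a \<in> I"
  and ideal_right: "ideal I \<Longrightarrow> a \<in> I \<Longrightarrow> a \<bullet> x \<in> I"
  by (auto simp: ideal_def)

lemma ideal_sum:
  assumes "ideal I" "ideal J"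
  shows "ideal {a + b | a b. a \<in> I \<and> b \<in> J}"
  unfolding ideal_def
proof (intro conjI allI ballI)
  show "subspace {a + b | a b. a \<in> I \<and> b \<in> J}"
    using assms by (intro subspace_sums ideal_subspace)
  fix x c assume "c \<in> {a + b | a b. a \<in> I \<and> b \<in> J}"
  then obtain a b where c: "c = a + b" "a \<in> I" "b \<in> J" by blast
  have "x \<bullet> c = x \<bullet> a + x \<bullet> b" "c \<bullet> x = a \<bullet> x + b \<bullet> x" by (simp_all add: c prd_distribs)
  moreover have "x \<bullet> a \<in> I" "a \<bullet> x \<in> I" "x \<bullet> b \<in> J" "b \<bullet> x \<in> J"
    using c assms by (auto simp: ideal_left ideal_right)
  ultimately show "x \<bullet> c \<in> {a + b | a b. a \<in> I \<and> b \<in> J}" "c \<bullet> x \<in> {a + b | a b. a \<in> I \<and> b \<in> J}"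
    by blast+
qed

lemma ideal_Int: "ideal I \<Longrightarrow> ideal J \<Longrightarrow> ideal (I \<inter> J)"
  by (auto simp: ideal_def intro: subspace_inter)

text \<open>\<open>(J \<inter> A) + I\<close> is an ideal between \<open>I\<close> and
  \<open>A\<close>, so it equals one of them.\<close>

lemma chief_factor_cases:
  assumes cf: "chief_factor A I" and J: "ideal J"
  obtains "J \<inter> A \<subseteq> I" | "\<And>a. a \<in> A \<Longrightarrow> \<exists>j\<in>J \<inter> A. a - j \<in> I"
proof -
  have A: "ideal A" and I: "ideal I" and "I \<subset> A"
    using cf by (auto simp: chief_factor_def)
  note sA = ideal_subspace[OF A] and sI = ideal_subspace[OF I]
    and sJA = ideal_subspace[OF ideal_Int[OF J A]]
  define S where "S = {a + b | a b. a \<in> J \<inter> A \<and> b \<in> I}"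
  have "ideal S" unfolding S_def using A I J by (intro ideal_sum ideal_Int)
  moreover have "I \<subseteq> S"
    using subspace_0[OF sJA] unfolding S_def by force
  moreover have "S \<subseteq> A"
    using \<open>I \<subset> A\<close> subspace_add[OF sA] by (auto simp: S_def)
  ultimately consider "S = I" | "S = A" using cf by (auto simp: chief_factor_def)
  then show ?thesis
  proof cases
    case 1
    have "J \<inter> A \<subseteq> S" using subspace_0[OF sI] unfolding S_def by force
    then show ?thesis using 1 that(1) by blast
  next
    case 2
    have "\<exists>j\<in>J \<inter> A. a - j \<in> I" if "a \<in> A" for a
    proof -
      have "a \<in> S" using 2 that by simp
      then obtain j b where "a = j + b" "j \<in> J \<inter> A" "b \<in> I" by (auto simp: S_def)
      then show ?thesis by (intro bexI[of _ j]) auto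
    qed
    then show ?thesis by (rule that(2))
  qed
qed

lemma ideal_derived_series: "ideal (derived_series UNIV k)"
  using left_stable_derived_series[OF subalgebra_UNIV, of k]
    right_stable_derived_series[OF subalgebra_UNIV, of _ _ k]
  by (auto simp: ideal_def left_stable_def)

text \<open>The last derived term of \<open>L\<close> whose intersection with \<open>A\<close> is
  not inside \<open>I\<close> covers \<open>A\<close> modulo \<open>I\<close>, and products of
  representatives fall into the next term.\<close>

lemma chief_factor_abelian:
  assumes cf: "chief_factor A I" and solv: "solvable UNIV" and ab: "a \<in> A" "b \<in> A"
  shows "a \<bullet> b \<in> I"
proof -
  have A: "ideal A" and I: "ideal I" and "I \<subset> A"
    using cf by (auto simp: chief_factor_def)
  note sI = ideal_subspace[OF I]
  define Q where "Q k \<longleftrightarrow> derived_series UNIV k \<inter> A \<subseteq> I" for k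
  obtain k0 where "derived_series UNIV k0 = {0}" using solv by (auto simp: solvable_def)
  then have "Q k0" using subspace_0[OF sI] by (auto simp: Q_def)
  have "\<not> Q 0" using \<open>I \<subset> A\<close> by (auto simp: Q_def)
  define m where "m = (LEAST k. Q k)"
  have m: "Q m" unfolding m_def using \<open>Q k0\<close> by (rule LeastI)
  then obtain k where k: "m = Suc k" using \<open>\<not> Q 0\<close> by (cases m) auto
  have "\<not> Q k" using not_less_Least[of k Q] k by (auto simp: m_def)
  then have nQ: "\<not> derived_series UNIV k \<inter> A \<subseteq> I" by (simp add: Q_def)
  have D: "\<exists>d\<in>derived_series UNIV k \<inter> A. a - d \<in> I" if "a \<in> A" for a
    by (rule chief_factor_cases[OF cf ideal_derived_series[of k]]) (use nQ that in auto)
  obtain c d where c: "c \<in> derived_series UNIV k" "c \<in> A" "a - c \<in> I"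
    and d: "d \<in> derived_series UNIV k" "d \<in> A" "b - d \<in> I"
    using D[OF ab(1)] D[OF ab(2)] by blast
  have "c \<bullet> d \<in> derived_series UNIV m \<inter> A"
    using c d ideal_left[OF A] by (simp add: k product_spaceI)
  then have "c \<bullet> d \<in> I" using m by (auto simp: Q_def)
  \<comment> \<open>This sum telescopes to \<open>a \<bullet> b\<close>.\<close>
  then have "c \<bullet> d + c \<bullet> (b - d) + (a - c) \<bullet> b \<in> I"
    using c d \<open>c \<bullet> d \<in> I\<close>
    by (blast intro: subspace_add[OF sI] ideal_left[OF I] ideal_right[OF I])
  then show ?thesis by (simp add: prd_distribs)
qed

text \<open>The Leibniz kernel: the obstruction to being a Lie algebra, and an ideal whose left
  multiplications are zero.\<close>

definition leib :: "'a set" where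
  "leib = span (range (\<lambda>y. y \<bullet> y))"

lemma square_in_leib: "y \<bullet> y \<in> leib"
  unfolding leib_def by (rule span_base) simp

lemma anticommutator_in_leib: "x \<bullet> y + y \<bullet> x \<in> leib"
proof -
  have "(x + y) \<bullet> (x + y) - x \<bullet> x - y \<bullet> y \<in> leib"
    using square_in_leib unfolding leib_def by (intro span_diff)
  then show ?thesis by (simp add: prd_distribs algebra_simps)
qed

lemma leib_prd:
  assumes "q \<in> leib"
  shows "q \<bullet> x = 0"
proof -
  have "q \<bullet> x \<in> {0}"
    using assms unfolding leib_def
    by (rule span_prd_left) (auto simp: square_prd subspace_single_0)
  then show ?thesis by simp
qed

lemma ideal_leib: "ideal leib"
  unfolding ideal_def
proof (intro conjI allI ballI)
  show s: "subspace leib" by (simp add: leib_def subspace_span)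
  fix x q assume q: "q \<in> leib"
  show "q \<bullet> x \<in> leib" using leib_prd[OF q] subspace_0[OF s] by simp
  have "q \<in> span (range (\<lambda>y. y \<bullet> y))" using q by (simp add: leib_def)
  then show "x \<bullet> q \<in> leib"
  proof (induction rule: span_induct)
    case base
    show ?case by (rule subspace_prd_right_preimage[OF s])
  next
    case (step q)
    then obtain y where "q = y \<bullet> y" by auto
    \<comment> \<open>\<open>x \<bullet> (y \<bullet> y)\<close> is the anticommutator of
      \<open>x \<bullet> y\<close> and \<open>y\<close>.\<close>
    then show ?case using anticommutator_in_leib[of "x \<bullet> y" y] by (simp add: left_leibniz[of x y y])
  qed
qed

text \<open>Apply \<open>chief_factor_cases\<close> to the Leibniz kernel. If it meets
  \<open>A\<close> inside \<open>I\<close>, anticommutators vanish modulo \<open>I\<close>; if it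
  covers \<open>A\<close> modulo \<open>I\<close>, left multiplications by \<open>A\<close> do. This
  stands in for antisymmetry.\<close>

lemma chief_factor_right_action:
  assumes cf: "chief_factor A I"
  shows "(\<forall>a\<in>A. \<forall>x. a \<bullet> x \<in> I) \<or> (\<forall>a\<in>A. \<forall>x. a \<bullet> x + x \<bullet> a \<in> I)"
proof -
  have A: "ideal A" and I: "ideal I" using cf by (auto simp: chief_factor_def)
  show ?thesis
  proof (rule chief_factor_cases[OF cf ideal_leib])
    assume "leib \<inter> A \<subseteq> I"
    moreover have "a \<bullet> x + x \<bullet> a \<in> leib \<inter> A" if "a \<in> A" for a x
      using that anticommutator_in_leib ideal_left[OF A] ideal_right[OF A]
      by (auto intro: subspace_add ideal_subspace[OF A])
    ultimately show ?thesis by blast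
  next
    assume *: "\<And>a. a \<in> A \<Longrightarrow> \<exists>q\<in>leib \<inter> A. a - q \<in> I"
    have "a \<bullet> x \<in> I" if "a \<in> A" for a x
    proof -
      obtain q where q: "q \<in> leib" "a - q \<in> I" using *[of a] \<open>a \<in> A\<close> by auto
      have "(a - q) \<bullet> x \<in> I" using q by (intro ideal_right[OF I])
      then show ?thesis using leib_prd[OF q(1)] by (simp add: prd_diff_left)
    qed
    then show ?thesis by blast
  qed
qed

section \<open>Maximal subalgebras complementing a chief factor\<close>

lemma maximal_subalgebra_sum:
  assumes M: "maximal_subalgebra M" and A: "ideal A" and "\<not> A \<subseteq> M"
  obtains m a where "m \<in> M" "a \<in> A" "x = m + a"
proof -
  have sub: "subalgebra M" and sM: "subspace M"
    using M by (auto simp: maximal_subalgebra_def subalgebra_def)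
  note sA = ideal_subspace[OF A]
  define U where "U = {m + a | m a. m \<in> M \<and> a \<in> A}"
  have "subalgebra U"
    unfolding subalgebra_def
  proof (intro conjI ballI)
    show "subspace U" unfolding U_def using sM sA by (rule subspace_sums)
    fix u v assume "u \<in> U" "v \<in> U"
    then obtain m a n b where uv: "u = m + a" "v = n + b" "m \<in> M" "a \<in> A" "n \<in> M" "b \<in> A"
      by (auto simp: U_def)
    have "u \<bullet> v = m \<bullet> n + (m \<bullet> b + a \<bullet> v)" by (simp add: uv prd_distribs algebra_simps)
    moreover have "m \<bullet> n \<in> M" using uv sub by (simp add: subalgebra_def)
    moreover have "m \<bullet> b + a \<bullet> v \<in> A"
      using uv by (intro subspace_add[OF sA] ideal_left[OF A] ideal_right[OF A])
    ultimately show "u \<bullet> v \<in> U" unfolding U_def by blast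
  qed
  moreover have "M \<subseteq> U" using subspace_0[OF sA] unfolding U_def by force
  moreover have "A \<subseteq> U" using subspace_0[OF sM] unfolding U_def by force
  then have "U \<noteq> M" using \<open>\<not> A \<subseteq> M\<close> by blast
  ultimately have "U = UNIV" using M unfolding maximal_subalgebra_def by blast
  then have "x \<in> U" by simp
  then show ?thesis using that unfolding U_def by blast
qed

text \<open>As \<open>L = M + A\<close>, it is enough that \<open>M \<inter> A\<close> absorbs
  products with \<open>M\<close> and with \<open>A\<close>; the latter fall into \<open>I\<close>
  because \<open>A/I\<close> is abelian. So the intersection is an ideal inside \<open>M\<close>,
  hence inside the core.\<close>

lemma maximal_subalgebra_Int_chief_factor:
  assumes M: "maximal_subalgebra M" and core: "core M = I" and cf: "chief_factor A I"
    and "\<not> A \<subseteq> M" and solv: "solvable UNIV"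
  shows "M \<inter> A \<subseteq> I"
proof -
  have sub: "subalgebra M" and sM: "subspace M"
    using M by (auto simp: maximal_subalgebra_def subalgebra_def)
  have A: "ideal A" and I: "ideal I" and "I \<subset> A" using cf by (auto simp: chief_factor_def)
  have "I \<subseteq> M" using core_greatest(2)[OF sM] core by simp
  note sMA = subspace_inter[OF sM ideal_subspace[OF A]]
  have "ideal (M \<inter> A)"
    unfolding ideal_def
  proof (intro conjI allI ballI sMA)
    fix y x assume x: "x \<in> M \<inter> A"
    obtain m a where y: "m \<in> M" "a \<in> A" "y = m + a"
      using maximal_subalgebra_sum[OF M A \<open>\<not> A \<subseteq> M\<close>] .
    have "m \<bullet> x \<in> M \<inter> A" "x \<bullet> m \<in> M \<inter> A"
      using x y sub ideal_left[OF A] ideal_right[OF A] by (auto simp: subalgebra_def)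
    moreover have "a \<bullet> x \<in> M \<inter> A" "x \<bullet> a \<in> M \<inter> A"
      using chief_factor_abelian[OF cf solv] x y \<open>I \<subseteq> M\<close> \<open>I \<subset> A\<close> by blast+
    ultimately show "y \<bullet> x \<in> M \<inter> A" "x \<bullet> y \<in> M \<inter> A"
      using subspace_add[OF sMA] by (auto simp: y(3) prd_distribs)
  qed
  then show ?thesis using core_greatest(3)[OF sM] core by blast
qed

text \<open>Since \<open>L = M + A\<close> and \<open>A\<close> acts as zero on \<open>A/I\<close>,
  an \<open>M\<close>-submodule between \<open>I\<close> and \<open>A\<close> is a left ideal;
  \<open>chief_factor_right_action\<close> makes it two-sided.\<close>

lemma chief_factor_irr_factor:
  assumes M: "maximal_subalgebra M" and cf: "chief_factor A I" and "\<not> A \<subseteq> M"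
    and solv: "solvable UNIV"
  shows "irr_factor M A I"
proof -
  have A: "ideal A" and I: "ideal I" and "I \<subset> A" using cf by (auto simp: chief_factor_def)
  have "J = I \<or> J = A" if J: "left_stable M J" "I \<subseteq> J" "J \<subseteq> A" for J
  proof -
    note sJ = left_stable_subspace[OF J(1)]
    have left: "y \<bullet> x \<in> J" if "x \<in> J" for x y
    proof -
      obtain m a where y: "m \<in> M" "a \<in> A" "y = m + a"
        using maximal_subalgebra_sum[OF M A \<open>\<not> A \<subseteq> M\<close>] .
      have "m \<bullet> x \<in> J" using J(1) y that by (simp add: left_stableD)
      moreover have "a \<bullet> x \<in> J" using chief_factor_abelian[OF cf solv] y that J by blast
      ultimately show ?thesis using subspace_add[OF sJ] by (simp add: y(3) prd_distribs)
    qed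
    have right: "x \<bullet> y \<in> J" if "x \<in> J" for x y
      using chief_factor_right_action[OF cf]
    proof
      assume "\<forall>a\<in>A. \<forall>x. a \<bullet> x \<in> I"
      then show ?thesis using that J by blast
    next
      assume "\<forall>a\<in>A. \<forall>x. a \<bullet> x + x \<bullet> a \<in> I"
      then have "x \<bullet> y + y \<bullet> x \<in> J" using that J by blast
      then show ?thesis using subspace_diff[OF sJ _ left[OF that, of y]] by force
    qed
    have "ideal J" using sJ left right by (auto simp: ideal_def)
    then show ?thesis using cf J by (auto simp: chief_factor_def)
  qed
  then show ?thesis
    using A I \<open>I \<subset> A\<close> by (auto simp: irr_factor_def left_stable_def ideal_def)
qed

text \<open>The elements of \<open>M\<close> acting as zero on \<open>A/I\<close> form an ideal of
  \<open>L\<close> inside \<open>M\<close>, hence lie in the core; so the action of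
  \<open>M/I\<close> is faithful.\<close>

lemma maximal_subalgebra_centralizer:
  assumes M: "maximal_subalgebra M" and core: "core M = I" and cf: "chief_factor A I"
    and "\<not> A \<subseteq> M" and x: "x \<in> M" "\<And>a. a \<in> A \<Longrightarrow> x \<bullet> a \<in> I"
  shows "x \<in> I"
proof -
  have sub: "subalgebra M" and sM: "subspace M"
    using M by (auto simp: maximal_subalgebra_def subalgebra_def)
  have A: "ideal A" and I: "ideal I" and "I \<subset> A" using cf by (auto simp: chief_factor_def)
  note sI = ideal_subspace[OF I]
  have "I \<subseteq> M" using core_greatest(2)[OF sM] core by simp
  define C where "C = {x \<in> M. \<forall>a\<in>A. x \<bullet> a \<in> I}"
  have sC: "subspace C"
    using sM sI by (auto simp: C_def subspace_def prd_distribs)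
  have IC: "I \<subseteq> C" using \<open>I \<subseteq> M\<close> ideal_right[OF I] by (auto simp: C_def)
  have "ideal C"
    unfolding ideal_def
  proof (intro conjI allI ballI sC)
    fix y x assume x: "x \<in> C"
    obtain m a where y: "m \<in> M" "a \<in> A" "y = m + a"
      using maximal_subalgebra_sum[OF M A \<open>\<not> A \<subseteq> M\<close>] .
    have xI: "x \<bullet> b \<in> I" if "b \<in> A" for b using x that by (auto simp: C_def)
    have "(m \<bullet> x) \<bullet> b \<in> I" "(x \<bullet> m) \<bullet> b \<in> I" if "b \<in> A" for b
      unfolding prd_prd_left using that xI ideal_left[OF A] ideal_left[OF I]
      by (auto intro!: subspace_diff[OF sI])
    then have m: "m \<bullet> x \<in> C" "x \<bullet> m \<in> C"
      using x y sub by (auto simp: C_def subalgebra_def)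
    have xa: "x \<bullet> a \<in> I" using xI y by blast
    have "a \<bullet> x \<in> I"
      using chief_factor_right_action[OF cf]
    proof
      assume "\<forall>a\<in>A. \<forall>x. a \<bullet> x + x \<bullet> a \<in> I"
      then have "a \<bullet> x + x \<bullet> a \<in> I" using y by blast
      then show ?thesis using subspace_diff[OF sI _ xa] by force
    qed (use y in blast)
    then have "a \<bullet> x \<in> C" "x \<bullet> a \<in> C" using xa IC by auto
    then show "y \<bullet> x \<in> C" "x \<bullet> y \<in> C"
      using m subspace_add[OF sC] by (auto simp: y(3) prd_distribs)
  qed
  then have "C \<subseteq> I" using core_greatest(3)[OF sM, of C] core by (auto simp: C_def)
  then show ?thesis using x by (auto simp: C_def)
qed

text \<open>\<open>N\<close> is the last derived term of \<open>M\<close> not inside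
  \<open>I\<close>; it exists because \<open>M \<noteq> I\<close>. By faithfulness it cannot act as
  zero on \<open>A/I\<close>, so \<open>irr_factor_trivial_or_inj\<close> yields
  \<open>n\<close>.\<close>

lemma maximal_subalgebra_regular_element:
  assumes M: "maximal_subalgebra M" and core: "core M = I" and cf: "chief_factor A I"
    and notA: "\<not> A \<subseteq> M" and solv: "solvable UNIV" and "M \<noteq> I"
  obtains N n where "N \<subseteq> M" "n \<in> N"
    "\<And>x y. x \<in> N \<Longrightarrow> y \<in> M \<Longrightarrow> x \<bullet> y \<in> N" "\<And>x y. x \<in> N \<Longrightarrow> y \<in> N \<Longrightarrow> x \<bullet> y \<in> I"
    "\<And>a. a \<in> A \<Longrightarrow> n \<bullet> a \<in> I \<Longrightarrow> a \<in> I"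
proof -
  have sub: "subalgebra M" and sM: "subspace M"
    using M by (auto simp: maximal_subalgebra_def subalgebra_def)
  have I: "ideal I" using cf by (auto simp: chief_factor_def)
  note sI = ideal_subspace[OF I]
  have "I \<subseteq> M" using core_greatest(2)[OF sM] core by simp
  define Q where "Q k \<longleftrightarrow> derived_series M k \<subseteq> I" for k
  obtain k0 where "derived_series UNIV k0 = {0}" using solv by (auto simp: solvable_def)
  then have "Q k0"
    using subspace_0[OF sI] derived_series_mono[of M UNIV k0] by (auto simp: Q_def)
  have "\<not> Q 0" using \<open>I \<subseteq> M\<close> \<open>M \<noteq> I\<close> by (auto simp: Q_def)
  define l where "l = (LEAST k. Q k)"
  have l: "Q l" unfolding l_def using \<open>Q k0\<close> by (rule LeastI)
  then obtain k where k: "l = Suc k" using \<open>\<not> Q 0\<close> by (cases l) auto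
  have "\<not> Q k" using not_less_Least[of k Q] k by (auto simp: l_def)
  define N where "N = derived_series M k"
  have N: "left_stable M N" unfolding N_def by (rule left_stable_derived_series[OF sub])
  have spN: "span N = N" using left_stable_subspace[OF N] by (simp add: span_eq_iff)
  have notN: "\<not> N \<subseteq> I" using \<open>\<not> Q k\<close> by (simp add: Q_def N_def)
  have NN: "x \<bullet> y \<in> I" if "x \<in> N" "y \<in> N" for x y
    using l that by (auto simp: Q_def k N_def product_spaceI)
  have NM: "N \<subseteq> M"
  proof -
    have "derived_series M j \<subseteq> M" for j
    proof (induction j)
      case (Suc j)
      then have "product_space (derived_series M j) (derived_series M j) \<subseteq> M"
        using sub by (intro product_space_subset[OF sM]) (auto simp: subalgebra_def)
      then show ?case by simp
    qed simp
    then show ?thesis by (simp add: N_def)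
  qed
  have "(\<forall>x\<in>span N. \<forall>a\<in>A. x \<bullet> a \<in> I) \<or> (\<exists>x\<in>N. \<forall>a\<in>A. x \<bullet> a \<in> I \<longrightarrow> a \<in> I)"
  proof (rule irr_factor_trivial_or_inj[OF chief_factor_irr_factor[OF M cf notA solv]])
    show "(x \<bullet> y) \<bullet> a \<in> I" if "x \<in> span N" "y \<in> span N" for x y a
      using NN that spN by (auto intro: ideal_right[OF I])
    show "span N \<subseteq> M" unfolding spN by (rule NM)
    show "y \<bullet> x \<in> span N" if "y \<in> M" "x \<in> span N" for x y
      using left_stableD[OF N] that unfolding spN by blast
  qed
  moreover have "\<not> (\<forall>x\<in>span N. \<forall>a\<in>A. x \<bullet> a \<in> I)"
  proof
    assume "\<forall>x\<in>span N. \<forall>a\<in>A. x \<bullet> a \<in> I"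
    then have *: "x \<bullet> a \<in> I" if "x \<in> N" "a \<in> A" for x a
      using that unfolding spN by blast
    have "x \<in> I" if "x \<in> N" for x
      by (rule maximal_subalgebra_centralizer[OF M core cf notA subsetD[OF NM that] *[OF that]])
    then show False using notN by blast
  qed
  ultimately obtain n where n: "n \<in> N" "\<And>a. a \<in> A \<Longrightarrow> n \<bullet> a \<in> I \<Longrightarrow> a \<in> I" by blast
  have "x \<bullet> y \<in> N" if "x \<in> N" "y \<in> M" for x y
    using right_stable_derived_series[OF sub] that by (simp add: N_def)
  then show ?thesis using that NM n NN by blast
qed

text \<open>\<open>M\<close> and \<open>K\<close> both complement \<open>A/I\<close>, so \<open>K\<close> is the graph of a cocycle \<open>M \<rightarrow> A/I\<close>, \<open>m \<mapsto> c\<close> with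
  \<open>m + c \<in> K\<close>.  Correcting it by a coboundary makes it vanish at the regular element \<open>n\<close>, and then
  the cocycle identity makes it vanish on \<open>N\<close> and on \<open>M\<close>.\<close>

lemma complement_shift:
  assumes M: "maximal_subalgebra M" and K: "maximal_subalgebra K"
    and coreM: "core M = I" and coreK: "core K = I" and cf: "chief_factor A I"
    and AM: "\<not> A \<subseteq> M" and AK: "\<not> A \<subseteq> K" and solv: "solvable UNIV" and "M \<noteq> I"
  obtains x where "x \<in> A" "x \<in> L2" "\<And>m. m \<in> M \<Longrightarrow> m + x \<bullet> m \<in> K"
proof -
  have subK: "subalgebra K" and sK: "subspace K"
    using K by (auto simp: maximal_subalgebra_def subalgebra_def)
  have A: "ideal A" and I: "ideal I" and IA: "I \<subset> A" using cf by (auto simp: chief_factor_def)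
  note sI = ideal_subspace[OF I] and sA = ideal_subspace[OF A]
  have IK: "I \<subseteq> K" using core_greatest(2)[OF sK] coreK by simp
  have KA: "y \<in> I" if "y \<in> K" "y \<in> A" for y
    using maximal_subalgebra_Int_chief_factor[OF K coreK cf AK solv] that by blast
  have AA: "a \<bullet> b \<in> I" if "a \<in> A" "b \<in> A" for a b
    using chief_factor_abelian[OF cf solv that] .
  have KK: "u \<bullet> v \<in> K" if "u \<in> K" "v \<in> K" for u v
    using subK that by (simp add: subalgebra_def)
  obtain N n where NM: "N \<subseteq> M" and n: "n \<in> N"
    and NMN: "\<And>x y. x \<in> N \<Longrightarrow> y \<in> M \<Longrightarrow> x \<bullet> y \<in> N"
    and NN: "\<And>x y. x \<in> N \<Longrightarrow> y \<in> N \<Longrightarrow> x \<bullet> y \<in> I"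
    and inj: "\<And>a. a \<in> A \<Longrightarrow> n \<bullet> a \<in> I \<Longrightarrow> a \<in> I"
    using maximal_subalgebra_regular_element[OF M coreM cf AM solv \<open>M \<noteq> I\<close>] by metis
  have comp: "\<exists>c\<in>A. m + c \<in> K" for m
  proof -
    obtain k a where "k \<in> K" "a \<in> A" "m = k + a" using maximal_subalgebra_sum[OF K A AK] .
    then show ?thesis using subspace_neg[OF sA] by (intro bexI[of _ "- a"]) auto
  qed
  have surj: "\<exists>u\<in>A. v - n \<bullet> u \<in> I" if v: "v \<in> A" for v
  proof -
    have "left_stable {n} A" "left_stable {n} I"
      using A I by (auto simp: left_stable_def ideal_def)
    then show ?thesis
      using surj_mod_of_inj_mod[of n A I v] inj v psubset_imp_subset[OF IA] by metis
  qed
  obtain b where b: "b \<in> A" "n + b \<in> K" using comp by blast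
  obtain x where x: "x \<in> A" "x \<in> L2" "b - x \<bullet> n \<in> I"
    using chief_factor_right_action[OF cf]
  proof
    assume trivial: "\<forall>a\<in>A. \<forall>x. a \<bullet> x \<in> I"
    \<comment> \<open>In the expanded square all summands other than \<open>n \<bullet> b\<close>
      lie in \<open>I\<close>, so \<open>n \<bullet> b\<close> lies in \<open>K \<inter> A\<close>;
      hence \<open>b\<close> is already in \<open>I\<close> and \<open>x = 0\<close> works.\<close>
    have "(n + b) \<bullet> (n + b) - (n \<bullet> n + b \<bullet> (n + b)) \<in> K"
      using b NN[OF n n] trivial IK
      by (intro subspace_diff[OF sK] KK) (auto intro!: subspace_add[OF sK])
    then have "n \<bullet> b \<in> K" by (simp add: prd_distribs)
    then have "b \<in> I" using inj KA ideal_left[OF A b(1)] b by blast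
    then show ?thesis
      using that[of 0] subspace_0[OF sA] subspace_0[OF subspace_product_space] by simp
  next
    assume anti: "\<forall>a\<in>A. \<forall>x. a \<bullet> x + x \<bullet> a \<in> I"
    \<comment> \<open>Solving twice gives \<open>b\<close> congruent to
      \<open>n \<bullet> (n \<bullet> a1)\<close>, that is, to
      \<open>- (n \<bullet> a1) \<bullet> n\<close>. So \<open>x = - (n \<bullet> a1)\<close> works
      and lies in \<open>L2\<close>, being a product up to sign.\<close>
    obtain a0 where a0: "a0 \<in> A" "b - n \<bullet> a0 \<in> I" using surj b by blast
    obtain a1 where a1: "a1 \<in> A" "a0 - n \<bullet> a1 \<in> I" using surj a0 by blast
    have na1: "n \<bullet> a1 \<in> A" using a1 ideal_left[OF A] by blast
    have "(n \<bullet> a1) \<bullet> n + n \<bullet> (n \<bullet> a1) \<in> I" using anti na1 by blast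
    then have "(b - n \<bullet> a0) + n \<bullet> (a0 - n \<bullet> a1) + ((n \<bullet> a1) \<bullet> n + n \<bullet> (n \<bullet> a1)) \<in> I"
      using subspace_add[OF sI subspace_add[OF sI a0(2) ideal_left[OF I a1(2)]]] by blast
    then have "b - (- (n \<bullet> a1)) \<bullet> n \<in> I" by (simp add: prd_diff_right prd_minus_left algebra_simps)
    moreover have "- (n \<bullet> a1) \<in> L2"
      by (intro subspace_neg[OF subspace_product_space] product_spaceI) auto
    ultimately show ?thesis using that subspace_neg[OF sA na1] by blast
  qed
  have xn: "n \<bullet> (x \<bullet> y) = x \<bullet> (n \<bullet> y) - (x \<bullet> n) \<bullet> y" for y
    by (simp add: prd_prd_left)
  \<comment> \<open>Modulo \<open>I\<close>, \<open>x \<bullet> n\<close> is \<open>b\<close> and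
    products in \<open>N\<close> and in \<open>A\<close> vanish. So
    \<open>n \<bullet> (c - x \<bullet> y)\<close> is congruent to
    \<open>n \<bullet> c + b \<bullet> y\<close>, and so is
    \<open>(n + b) \<bullet> (y + c)\<close>; this puts it into \<open>K \<inter> A\<close>.\<close>
  have onN: "c - x \<bullet> y \<in> I" if y: "y \<in> N" and c: "c \<in> A" "y + c \<in> K" for y c
  proof (rule inj)
    show "c - x \<bullet> y \<in> A" using c x ideal_right[OF A] by (intro subspace_diff[OF sA])
    have "(n + b) \<bullet> (y + c) - n \<bullet> y - b \<bullet> c \<in> K"
      using NN[OF n y] AA[OF b(1) c(1)] IK by (intro subspace_diff[OF sK] KK[OF b(2) c(2)]) auto
    then have "n \<bullet> c + b \<bullet> y \<in> K" by (simp add: prd_distribs algebra_simps)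
    moreover have "n \<bullet> c + b \<bullet> y \<in> A"
      using b c by (intro subspace_add[OF sA] ideal_left[OF A] ideal_right[OF A])
    ultimately have "n \<bullet> c + b \<bullet> y - (b - x \<bullet> n) \<bullet> y - x \<bullet> (n \<bullet> y) \<in> I"
      by (intro subspace_diff[OF sI] KA ideal_right[OF I x(3)] ideal_left[OF I NN[OF n y]])
    then show "n \<bullet> (c - x \<bullet> y) \<in> I"
      unfolding prd_diff_right[of n] xn by (simp add: prd_diff_left algebra_simps)
  qed
  have "m + x \<bullet> m \<in> K" if m: "m \<in> M" for m
  proof -
    obtain c where c: "c \<in> A" "m + c \<in> K" using comp by blast
    obtain c' where c': "c' \<in> A" "n \<bullet> m + c' \<in> K" using comp by blast
    \<comment> \<open>\<open>m\<close> may lie outside \<open>N\<close>, but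
      \<open>n \<bullet> m\<close> lies in \<open>N\<close>, where the shift is already known modulo
      \<open>I\<close>; cancelling \<open>n\<close> carries the result over to
      \<open>m\<close>.\<close>
    have nm: "c' - x \<bullet> (n \<bullet> m) \<in> I" using onN NMN n m c' by blast
    have "(n + b) \<bullet> (m + c) - (n \<bullet> m + c') \<in> K"
      using b c c' by (intro subspace_diff[OF sK] KK)
    then have "n \<bullet> c + b \<bullet> m + b \<bullet> c - c' \<in> K" by (simp add: prd_distribs algebra_simps)
    moreover have "n \<bullet> c + b \<bullet> m + b \<bullet> c - c' \<in> A"
      using b c c' by (intro subspace_add[OF sA] subspace_diff[OF sA] ideal_left[OF A] ideal_right[OF A])
    ultimately have "n \<bullet> c + b \<bullet> m + b \<bullet> c - c' \<in> I" by (rule KA)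
    then have "(n \<bullet> c + b \<bullet> m + b \<bullet> c - c') + (c' - x \<bullet> (n \<bullet> m)) - (b - x \<bullet> n) \<bullet> m - b \<bullet> c \<in> I"
      by (intro subspace_diff[OF sI subspace_diff[OF sI subspace_add[OF sI _ nm]
          ideal_right[OF I x(3)]] AA[OF b(1) c(1)]])
    then have "n \<bullet> (c - x \<bullet> m) \<in> I"
      unfolding prd_diff_right[of n] xn by (simp add: prd_diff_left algebra_simps)
    with inj[OF subspace_diff[OF sA c(1) ideal_right[OF A x(1)]]] have "c - x \<bullet> m \<in> I" .
    then have "(m + c) - (c - x \<bullet> m) \<in> K" using c(2) IK by (blast intro: subspace_diff[OF sK])
    then show ?thesis by simp
  qed
  then show ?thesis using that x by blast
qed

text \<open>All terms of the series from the second power on are iterates of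
  \<open>x \<bullet> (x \<bullet> m)\<close>, so they lie in \<open>I\<close>.\<close>

lemma exp_L_mem_of_square_zero_mod:
  assumes N: "exp_bound N x" and sK: "subspace K" and I: "ideal I" "I \<subseteq> K"
    and m: "m + x \<bullet> m \<in> K" "x \<bullet> (x \<bullet> m) \<in> I"
  shows "exp_L x m \<in> K"
proof -
  \<comment> \<open>The bound is raised by two so that two terms can be split off whatever
    \<open>N\<close> is; the added powers are zero, so their factorials do no harm.\<close>
  have "((\<bullet>) x ^^ Suc (Suc N)) v = 0" for v
    using N by (simp add: exp_bound_def)
  then have "exp_L x m = (\<Sum>r<Suc (Suc N). (1 / of_nat (fact r)) *s ((\<bullet>) x ^^ r) m)"
    by (rule exp_L_eq_sum)
  also have "\<dots> = (m + x \<bullet> m) + (\<Sum>r<N. (1 / of_nat (fact (Suc (Suc r)))) *s ((\<bullet>) x ^^ r) (x \<bullet> (x \<bullet> m)))"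
    by (simp only: sum.lessThan_Suc_shift funpow_Suc_right) simp
  also have "\<dots> \<in> K"
  proof (rule subspace_add[OF sK m(1)], rule subspace_sum[OF sK], rule subspace_scale[OF sK])
    fix r
    have "left_stable {x} I" using I by (auto simp: left_stable_def ideal_def)
    then show "((\<bullet>) x ^^ r) (x \<bullet> (x \<bullet> m)) \<in> K" using pow_left_stable[of "{x}" I x] m(2) I(2) by blast
  qed
  finally show ?thesis .
qed

text \<open>The preimage of \<open>K\<close> is a proper subalgebra containing \<open>M\<close>, so
  it is \<open>M\<close>.\<close>

lemma maximal_subalgebra_image_eq:
  assumes f: "automorphism f" and M: "maximal_subalgebra M" and K: "maximal_subalgebra K"
    and sub: "f ` M \<subseteq> K"
  shows "f ` M = K"
proof -
  have lin: "Vector_Spaces.linear scale scale f" and bij: "bij f"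
    and hom: "\<And>x y. f (x \<bullet> y) = f x \<bullet> f y"
    using f by (auto simp: automorphism_def)
  interpret f: Vector_Spaces.linear scale scale f by (rule lin)
  have "subalgebra {y. f y \<in> K}"
    using K by (auto simp: maximal_subalgebra_def subalgebra_def subspace_def hom f.zero f.add f.scale)
  moreover have "M \<subseteq> {y. f y \<in> K}" using sub by auto
  moreover have "{y. f y \<in> K} \<noteq> UNIV"
  proof
    assume "{y. f y \<in> K} = UNIV"
    then have "range f \<subseteq> K" by auto
    then show False using bij K by (auto simp: bij_def maximal_subalgebra_def)
  qed
  ultimately have "{y. f y \<in> K} = M" using M by (auto simp: maximal_subalgebra_def)
  moreover have "f ` {y. f y \<in> K} = K" using bij surj_image_vimage_eq[of f K] by (simp add: bij_def vimage_def)
  ultimately show ?thesis by simp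
qed

lemma exists_chief_factor:
  assumes "ideal I" "I \<noteq> UNIV"
  obtains A where "chief_factor A I"
proof -
  define P where "P A \<longleftrightarrow> ideal A \<and> I \<subset> A" for A
  have "P UNIV" using assms(2) by (auto simp: P_def ideal_def)
  then obtain A where A: "P A" "\<And>J. P J \<Longrightarrow> J \<subseteq> A \<Longrightarrow> J = A"
    by (rule finite_dim_minimal[of P UNIV]) (auto simp: P_def ideal_subspace)
  then have "chief_factor A I" using assms by (auto simp: chief_factor_def P_def)
  then show ?thesis by (rule that)
qed

lemma conjugate_of_core_eq:
  assumes bound: "\<And>x. x \<in> L2 \<Longrightarrow> \<exists>N. exp_bound N x" and solv: "solvable UNIV"
    and M: "maximal_subalgebra M" and K: "maximal_subalgebra K" and core: "core M = core K"
  shows "conjugate inner_Aut M K"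
proof -
  define I where "I = core M"
  have subM: "subspace M" "M \<noteq> UNIV" and subK: "subspace K" "subalgebra K" "K \<noteq> UNIV"
    using M K by (auto simp: maximal_subalgebra_def subalgebra_def)
  have I: "ideal I" "I \<subseteq> M" and IK: "I \<subseteq> K"
    using core_greatest(1,2)[OF subM(1)] core_greatest(2)[OF subK(1)] core by (auto simp: I_def)
  show ?thesis
  proof (cases "M = I")
    case True
    \<comment> \<open>An \<open>M\<close> that is its own core lies inside \<open>K\<close>, and its
      maximality forces equality.\<close>
    then have "K = M" using M IK subK by (auto simp: maximal_subalgebra_def)
    moreover have "id \<in> inner_Aut"
      using generate.one[of Aut "exp_L ` L2"] by (simp add: inner_Aut_def Aut_def)
    ultimately show ?thesis unfolding conjugate_def by (intro bexI[of _ id]) auto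
  next
    case False
    obtain A where cf: "chief_factor A I"
      using exists_chief_factor[of I] I subM by blast
    then have A: "ideal A" "\<not> A \<subseteq> I" by (auto simp: chief_factor_def)
    have "\<not> A \<subseteq> M" "\<not> A \<subseteq> K"
      using core_greatest(3)[OF subM(1) A(1)] core_greatest(3)[OF subK(1) A(1)] A(2) core
      by (auto simp: I_def)
    then obtain x where x: "x \<in> A" "x \<in> L2" "\<And>m. m \<in> M \<Longrightarrow> m + x \<bullet> m \<in> K"
      using complement_shift[OF M K _ _ cf _ _ solv False] core by (metis I_def)
    obtain N where N: "exp_bound N x" using bound x(2) by blast
    have "exp_L x m \<in> K" if "m \<in> M" for m
    proof (rule exp_L_mem_of_square_zero_mod[OF N subK(1) I(1) IK x(3)[OF that]])
      show "x \<bullet> (x \<bullet> m) \<in> I"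
        using x(1) A(1) by (intro chief_factor_abelian[OF cf solv] ideal_right)
    qed
    then have "exp_L x ` M = K"
      by (intro maximal_subalgebra_image_eq[OF automorphism_exp_L[OF N] M K]) auto
    moreover have "exp_L x \<in> inner_Aut"
      unfolding inner_Aut_def using x(2) by (intro generate.incl) auto
    ultimately show ?thesis unfolding conjugate_def by blast
  qed
qed

end

theorem theorem3:
  fixes scale :: "'f::field \<Rightarrow> 'a::ab_group_add \<Rightarrow> 'a"
    and prd :: "'a \<Rightarrow> 'a \<Rightarrow> 'a"
    and M K :: "'a set"
  assumes "leibniz_algebra scale prd"
    and "leibniz_algebra.solvable scale prd UNIV"
    and "CHAR('f) > 0 \<Longrightarrow>
      leibniz_algebra.nilpotent scale prd (leibniz_algebra.L2 scale prd) \<and>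
      leibniz_algebra.nilpotency_class scale prd (leibniz_algebra.L2 scale prd) < CHAR('f)"
    and "leibniz_algebra.maximal_subalgebra scale prd M"
    and "leibniz_algebra.maximal_subalgebra scale prd K"
  shows "leibniz_algebra.conjugate (leibniz_algebra.inner_Aut scale prd) M K \<longleftrightarrow>
    leibniz_algebra.core scale prd M = leibniz_algebra.core scale prd K"
proof -
  interpret leibniz_algebra scale prd by (rule assms(1))
  have bound: "\<exists>N. exp_bound N x" if "x \<in> L2" for x
  proof (cases "CHAR('f) = 0")
    case True
    then show ?thesis using exp_bound_char_0[OF True assms(2) that] by blast
  next
    case False
    then show ?thesis using exp_bound_char_p[OF _ _ _ that] assms(3) by blast
  qed
  have "subspace M" "subspace K"
    using assms(4,5) by (auto simp: maximal_subalgebra_def subalgebra_def)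
  then show ?thesis
    using core_eq_of_conjugate[OF bound] conjugate_of_core_eq[OF bound assms(2,4,5)] by blast
qed

end
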